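(* Let $(M(c),\varphi,\xi,\eta,g)$ be a conformal Kenmotsu space form and let $\acute{M}$ be a CR-hypersurface of $M(c)$ with unit normal vector field $N$ whose shape operator $A$ is Lie $\xi$-parallel. Suppose that the Lee vector field satisfies $\omega^{\sharp}=N$ along $\acute{M}$. Then $\acute{M}$ is totally umbilic.
   Context: An almost contact metric structure $(\varphi,\xi,\eta,g)$ on a $(2n+1)$-dimensional smooth manifold $M$ consists of a $(1,1)$-tensor field $\varphi$, a vector field $\xi$, a 1-form $\eta$ and a Riemannian metric $g$ with $\varphi^2=-\mathrm{Id}+\eta\otimes\xi$, $\eta(\xi)=1$, $\varphi\xi=0$, $\eta\circ\varphi=0$, $g(\varphi X,\varphi Y)=g(X,Y)-\eta(X)\eta(Y)$, $\eta(X)=g(X,\xi)$. It is a Kenmotsu structure if $(\nabla_X\varphi)Y=-g(X,\varphi Y)\xi-\eta(Y)\varphi X$, with $\nabla$ the Levi-Civita connection of $g$. $(M,\varphi,\xi,\eta,g)$ is a conformal Kenmotsu manifold if there is a positive smooth function $f:M\to\mathbb{R}$ (fixed throughout) such that $(\varphi,\ \tilde\xi=e^{-f/2}\xi,\ \tilde\eta=e^{f/2}\eta,\ \tilde g=e^{f}g)$ is a Kenmotsu structure on $M$. It is a conformal Kenmotsu space form, denoted $M(c)$, if moreover this Kenmotsu structure has constant $\varphi$-holomorphic sectional curvature $c$, i.e. the $\tilde g$-sectional curvature of $\mathrm{span}\{X,\varphi X\}$ equals the constant $c$ for all nonzero $X$ orthogonal to $\tilde\xi$. The 1-form $\omega$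 is $\omega(X)=X(f)$, and the Lee vector field is $\omega^{\sharp}=\mathrm{grad} f$ (gradient with respect to $g$). A CR-hypersurface of $M$ is a $2n$-dimensional embedded submanifold $\acute{M}$ such that $\xi$ is tangent to $\acute{M}$ and $T\acute{M}$ is an orthogonal direct sum of distributions $D\oplus D^{\perp}$ with $\varphi(D_p)\subset D_p$ and $\varphi(D^{\perp}_p)\subset T_p^{\perp}\acute{M}$ for all $p\in\acute M$. With $N$ a unit normal vector field of $\acute{M}$ and $U=-\varphi N$, one takes $D^{\perp}=\mathrm{span}\{U,\xi\}$ and $D$ its orthogonal complement in $T\acute{M}$. $A$ is the shape operator with respect to $N$: $AX=-\nabla_XN$ for $X\in T\acute M$, where $\nabla$ is the Levi-Civita connection of $g$. $A$ is Lie $\xi$-parallel if $(L_{\xi}A)X=0$ for every $X$ tangent to $\acute{M}$, where $L_\xi$ is the Lie derivative along $\xi$. Totally umbilic means that $A=\mu\,\mathrm{Id}$ for some function $\mu$ on $\acute M$. *)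

theory Defs
  imports "HOL-Analysis.Analysis" "HOL-Library.Function_Algebras"
begin

text \<open>Pointwise real vector space structure on functions; addition is that of
  \<^theory>\<open>HOL-Library.Function_Algebras\<close>.  It is used for tangent vectors (operators on functions)
  and for vector fields.\<close>

instantiation "fun" :: (type, scaleR) scaleR
begin
definition scaleR_fun :: "real \<Rightarrow> ('a \<Rightarrow> 'b) \<Rightarrow> 'a \<Rightarrow> 'b"
  where "scaleR_fun r f = (\<lambda>x. r *\<^sub>R f x)"
instance ..
end

instance "fun" :: (type, real_vector) real_vector
  by standard (auto simp: fun_eq_iff scaleR_fun_def scaleR_add_left scaleR_add_right)


subsection \<open>Smooth manifolds\<close>

text \<open>\<open>C\<^sup>k\<close>-functions on open sets \<open>U\<close> (the derivatives are full derivatives, not derivatives within \<open>U\<close>).\<close>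

primrec Ck_on :: "nat \<Rightarrow> ('a::real_normed_vector \<Rightarrow> 'b::real_normed_vector) \<Rightarrow> 'a set \<Rightarrow> bool"
  where
    "Ck_on 0 f U \<longleftrightarrow> continuous_on U f"
  | "Ck_on (Suc k) f U \<longleftrightarrow> (\<forall>x\<in>U. f differentiable (at x)) \<and>
       (\<forall>v. Ck_on k (\<lambda>x. frechet_derivative f (at x) v) U)"

definition smooth_on :: "('a::real_normed_vector \<Rightarrow> 'b::real_normed_vector) \<Rightarrow> 'a set \<Rightarrow> bool"
  where "smooth_on f U \<longleftrightarrow> (\<forall>k. Ck_on k f U)"

text \<open>A chart is a pair of its domain and its coordinate map; the values of the coordinate map
  off the domain are irrelevant.\<close>

type_synonym ('m, 'e) chart = "'m set \<times> ('m \<Rightarrow> 'e)"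

definition chart_inv :: "('m, 'e) chart \<Rightarrow> 'e \<Rightarrow> 'm"
  where "chart_inv c = inv_into (fst c) (snd c)"

definition is_chart :: "('m::topological_space, 'e::euclidean_space) chart \<Rightarrow> bool"
  where "is_chart c \<longleftrightarrow> open (fst c) \<and> open (snd c ` fst c) \<and>
    homeomorphism (fst c) (snd c ` fst c) (snd c) (chart_inv c)"

definition compatible ::
  "('m::topological_space, 'e::euclidean_space) chart \<Rightarrow> ('m, 'e) chart \<Rightarrow> bool"
  where "compatible c d \<longleftrightarrow>
    smooth_on (snd d \<circ> chart_inv c) (snd c ` (fst c \<inter> fst d)) \<and>
    smooth_on (snd c \<circ> chart_inv d) (snd d ` (fst c \<inter> fst d))"

text \<open>The manifold is the whole type \<open>'m\<close>, modelled on the Euclidean space \<open>'e\<close>.\<close>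

definition smooth_atlas ::
  "('m::{t2_space,second_countable_topology}, 'e::euclidean_space) chart set \<Rightarrow> bool"
  where "smooth_atlas \<A> \<longleftrightarrow> (\<Union>c\<in>\<A>. fst c) = UNIV \<and> (\<forall>c\<in>\<A>. is_chart c) \<and>
    (\<forall>c\<in>\<A>. \<forall>d\<in>\<A>. compatible c d)"

definition max_atlas ::
  "('m::topological_space, 'e::euclidean_space) chart set \<Rightarrow> ('m, 'e) chart set"
  where "max_atlas \<A> = {c. is_chart c \<and> (\<forall>d\<in>\<A>. compatible c d)}"

definition smooth_fun :: "('m, 'e::euclidean_space) chart set \<Rightarrow> ('m \<Rightarrow> real) \<Rightarrow> bool"
  where "smooth_fun \<A> h \<longleftrightarrow> (\<forall>c\<in>\<A>. smooth_on (h \<circ> chart_inv c) (snd c ` fst c))"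


subsection \<open>Tangent vectors and vector fields\<close>

text \<open>A tangent vector is the operator of directional differentiation acting on smooth functions.
  Operators are set to \<open>0\<close> on functions that are not smooth, so that two tangent vectors are equal
  iff they agree on all smooth functions.\<close>

type_synonym 'm tvec = "('m \<Rightarrow> real) \<Rightarrow> real"
type_synonym 'm vfield = "'m \<Rightarrow> 'm tvec"

definition dir_deriv ::
  "('m, 'e::euclidean_space) chart set \<Rightarrow> ('m, 'e) chart \<Rightarrow> 'm \<Rightarrow> 'e \<Rightarrow> 'm tvec"
  where "dir_deriv \<A> c p e =
    (\<lambda>h. if smooth_fun \<A> h then frechet_derivative (h \<circ> chart_inv c) (at (snd c p)) e else 0)"

definition tangent_space :: "('m, 'e::euclidean_space) chart set \<Rightarrow> 'm \<Rightarrow> 'm tvec set"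
  where "tangent_space \<A> p = {dir_deriv \<A> c p e | c e. c \<in> \<A> \<and> p \<in> fst c}"

definition vector_field :: "('m, 'e::euclidean_space) chart set \<Rightarrow> 'm vfield \<Rightarrow> bool"
  where "vector_field \<A> X \<longleftrightarrow> (\<forall>p. X p \<in> tangent_space \<A> p) \<and>
    (\<forall>h. smooth_fun \<A> h \<longrightarrow> smooth_fun \<A> (\<lambda>p. X p h))"

definition lie_bracket :: "'m vfield \<Rightarrow> 'm vfield \<Rightarrow> 'm vfield"
  where "lie_bracket X Y p = (\<lambda>h. X p (\<lambda>q. Y q h) - Y p (\<lambda>q. X q h))"


subsection \<open>Tensor fields, Riemannian metrics, connections, curvature\<close>

definition lin_on :: "'a::real_vector set \<Rightarrow> ('a \<Rightarrow> 'b::real_vector) \<Rightarrow> bool"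
  where "lin_on T L \<longleftrightarrow>
    (\<forall>u\<in>T. \<forall>v\<in>T. \<forall>a b. L (a *\<^sub>R u + b *\<^sub>R v) = a *\<^sub>R L u + b *\<^sub>R L v)"

definition one_form ::
  "('m, 'e::euclidean_space) chart set \<Rightarrow> ('m \<Rightarrow> 'm tvec \<Rightarrow> real) \<Rightarrow> bool"
  where "one_form \<A> \<eta> \<longleftrightarrow> (\<forall>p. lin_on (tangent_space \<A> p) (\<eta> p)) \<and>
    (\<forall>X. vector_field \<A> X \<longrightarrow> smooth_fun \<A> (\<lambda>p. \<eta> p (X p)))"

definition tensor_field11 ::
  "('m, 'e::euclidean_space) chart set \<Rightarrow> ('m \<Rightarrow> 'm tvec \<Rightarrow> 'm tvec) \<Rightarrow> bool"
  where "tensor_field11 \<A> \<phi> \<longleftrightarrow>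
    (\<forall>p. lin_on (tangent_space \<A> p) (\<phi> p) \<and> \<phi> p ` tangent_space \<A> p \<subseteq> tangent_space \<A> p) \<and>
    (\<forall>X. vector_field \<A> X \<longrightarrow> vector_field \<A> (\<lambda>p. \<phi> p (X p)))"

type_synonym 'm metric = "'m \<Rightarrow> 'm tvec \<Rightarrow> 'm tvec \<Rightarrow> real"

definition riemannian_metric :: "('m, 'e::euclidean_space) chart set \<Rightarrow> 'm metric \<Rightarrow> bool"
  where "riemannian_metric \<A> g \<longleftrightarrow>
    (\<forall>p. \<forall>u\<in>tangent_space \<A> p.
       lin_on (tangent_space \<A> p) (g p u) \<and>
       (\<forall>v\<in>tangent_space \<A> p. g p u v = g p v u) \<and>
       (u \<noteq> 0 \<longrightarrow> g p u u > 0)) \<and>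
    (\<forall>X Y. vector_field \<A> X \<longrightarrow> vector_field \<A> Y \<longrightarrow> smooth_fun \<A> (\<lambda>p. g p (X p) (Y p)))"

text \<open>For a connection \<open>nab\<close>, \<open>nab p v Y\<close> is the covariant derivative of the vector field
  \<open>Y\<close> in the direction \<open>v\<close> tangent at \<open>p\<close>, so it is linear over functions in the direction
  by construction.  The Levi-Civita connection is characterised as the metric and torsion-free
  one.\<close>

type_synonym 'm connection = "'m \<Rightarrow> 'm tvec \<Rightarrow> 'm vfield \<Rightarrow> 'm tvec"

definition affine_connection :: "('m, 'e::euclidean_space) chart set \<Rightarrow> 'm connection \<Rightarrow> bool"
  where "affine_connection \<A> nab \<longleftrightarrow>
    (\<forall>X Y. vector_field \<A> X \<longrightarrow> vector_field \<A> Y \<longrightarrow> vector_field \<A> (\<lambda>p. nab p (X p) Y)) \<and>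
    (\<forall>p Y. vector_field \<A> Y \<longrightarrow> lin_on (tangent_space \<A> p) (\<lambda>v. nab p v Y) \<and>
       (\<forall>v\<in>tangent_space \<A> p. nab p v Y \<in> tangent_space \<A> p)) \<and>
    (\<forall>p Y Z. \<forall>v\<in>tangent_space \<A> p. vector_field \<A> Y \<longrightarrow> vector_field \<A> Z \<longrightarrow>
       nab p v (Y + Z) = nab p v Y + nab p v Z) \<and>
    (\<forall>p Y h. \<forall>v\<in>tangent_space \<A> p. vector_field \<A> Y \<longrightarrow> smooth_fun \<A> h \<longrightarrow>
       nab p v (\<lambda>q. h q *\<^sub>R Y q) = v h *\<^sub>R Y p + h p *\<^sub>R nab p v Y)"

definition levi_civita ::
  "('m, 'e::euclidean_space) chart set \<Rightarrow> 'm metric \<Rightarrow> 'm connection \<Rightarrow> bool"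
  where "levi_civita \<A> g nab \<longleftrightarrow> affine_connection \<A> nab \<and>
    (\<forall>X Y p. vector_field \<A> X \<longrightarrow> vector_field \<A> Y \<longrightarrow>
       nab p (X p) Y - nab p (Y p) X = lie_bracket X Y p) \<and>
    (\<forall>p Y Z. \<forall>v\<in>tangent_space \<A> p. vector_field \<A> Y \<longrightarrow> vector_field \<A> Z \<longrightarrow>
       v (\<lambda>q. g q (Y q) (Z q)) = g p (nab p v Y) (Z p) + g p (Y p) (nab p v Z))"

definition curvature :: "'m connection \<Rightarrow> 'm vfield \<Rightarrow> 'm vfield \<Rightarrow> 'm vfield \<Rightarrow> 'm vfield"
  where "curvature nab X Y Z p =
    nab p (X p) (\<lambda>q. nab q (Y q) Z) - nab p (Y p) (\<lambda>q. nab q (X q) Z) - nab p (lie_bracket X Y p) Z"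

text \<open>Sectional curvature of the plane spanned by linearly independent \<open>u, v\<close> tangent at \<open>p\<close>;
  by tensoriality it does not depend on the vector fields \<open>X, Y\<close> extending \<open>u, v\<close>.\<close>

definition sectional_curvature ::
  "('m, 'e::euclidean_space) chart set \<Rightarrow> 'm metric \<Rightarrow> 'm connection \<Rightarrow>
   'm \<Rightarrow> 'm tvec \<Rightarrow> 'm tvec \<Rightarrow> real"
  where "sectional_curvature \<A> g nab p u v =
    (THE k. \<exists>X Y. vector_field \<A> X \<and> vector_field \<A> Y \<and> X p = u \<and> Y p = v \<and>
       k = g p (curvature nab X Y Y p) u / (g p u u * g p v v - (g p u v)\<^sup>2))"


subsection \<open>Conformal Kenmotsu space forms\<close>

definition almost_contact_metric ::
  "('m, 'e::euclidean_space) chart set \<Rightarrow> ('m \<Rightarrow> 'm tvec \<Rightarrow> 'm tvec) \<Rightarrow> 'm vfield \<Rightarrow>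
   ('m \<Rightarrow> 'm tvec \<Rightarrow> real) \<Rightarrow> 'm metric \<Rightarrow> bool"
  where "almost_contact_metric \<A> \<phi> \<xi> \<eta> g \<longleftrightarrow>
    tensor_field11 \<A> \<phi> \<and> vector_field \<A> \<xi> \<and> one_form \<A> \<eta> \<and> riemannian_metric \<A> g \<and>
    (\<forall>p. \<eta> p (\<xi> p) = 1 \<and> \<phi> p (\<xi> p) = 0 \<and>
      (\<forall>u\<in>tangent_space \<A> p.
         \<phi> p (\<phi> p u) = - u + \<eta> p u *\<^sub>R \<xi> p \<and>
         \<eta> p (\<phi> p u) = 0 \<and>
         \<eta> p u = g p u (\<xi> p) \<and>
         (\<forall>v\<in>tangent_space \<A> p. g p (\<phi> p u) (\<phi> p v) = g p u v - \<eta> p u * \<eta> p v)))"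

definition kenmotsu ::
  "('m, 'e::euclidean_space) chart set \<Rightarrow> ('m \<Rightarrow> 'm tvec \<Rightarrow> 'm tvec) \<Rightarrow> 'm vfield \<Rightarrow>
   ('m \<Rightarrow> 'm tvec \<Rightarrow> real) \<Rightarrow> 'm metric \<Rightarrow> bool"
  where "kenmotsu \<A> \<phi> \<xi> \<eta> g \<longleftrightarrow> almost_contact_metric \<A> \<phi> \<xi> \<eta> g \<and>
    (\<exists>nab. levi_civita \<A> g nab \<and>
      (\<forall>X Y p. vector_field \<A> X \<longrightarrow> vector_field \<A> Y \<longrightarrow>
         nab p (X p) (\<lambda>q. \<phi> q (Y q)) - \<phi> p (nab p (X p) Y) =
           - (g p (X p) (\<phi> p (Y p)) *\<^sub>R \<xi> p) - \<eta> p (Y p) *\<^sub>R \<phi> p (X p)))"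

definition phi_sectional_curvature_const ::
  "('m, 'e::euclidean_space) chart set \<Rightarrow> ('m \<Rightarrow> 'm tvec \<Rightarrow> 'm tvec) \<Rightarrow> 'm vfield \<Rightarrow>
   'm metric \<Rightarrow> real \<Rightarrow> bool"
  where "phi_sectional_curvature_const \<A> \<phi> \<xi> g c \<longleftrightarrow>
    (\<exists>nab. levi_civita \<A> g nab \<and>
      (\<forall>p. \<forall>u\<in>tangent_space \<A> p. u \<noteq> 0 \<longrightarrow> g p u (\<xi> p) = 0 \<longrightarrow>
         sectional_curvature \<A> g nab p u (\<phi> p u) = c))"

definition conf_xi :: "('m \<Rightarrow> real) \<Rightarrow> 'm vfield \<Rightarrow> 'm vfield"
  where "conf_xi f \<xi> = (\<lambda>p. exp (- f p / 2) *\<^sub>R \<xi> p)"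

definition conf_eta :: "('m \<Rightarrow> real) \<Rightarrow> ('m \<Rightarrow> 'm tvec \<Rightarrow> real) \<Rightarrow> 'm \<Rightarrow> 'm tvec \<Rightarrow> real"
  where "conf_eta f \<eta> = (\<lambda>p v. exp (f p / 2) * \<eta> p v)"

definition conf_metric :: "('m \<Rightarrow> real) \<Rightarrow> 'm metric \<Rightarrow> 'm metric"
  where "conf_metric f g = (\<lambda>p u v. exp (f p) * g p u v)"

definition conformal_kenmotsu ::
  "nat \<Rightarrow> ('m::{t2_space,second_countable_topology}, 'e::euclidean_space) chart set \<Rightarrow>
   ('m \<Rightarrow> 'm tvec \<Rightarrow> 'm tvec) \<Rightarrow> 'm vfield \<Rightarrow> ('m \<Rightarrow> 'm tvec \<Rightarrow> real) \<Rightarrow> 'm metric \<Rightarrow>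
   ('m \<Rightarrow> real) \<Rightarrow> bool"
  where "conformal_kenmotsu n \<A> \<phi> \<xi> \<eta> g f \<longleftrightarrow>
    smooth_atlas \<A> \<and> DIM('e) = 2 * n + 1 \<and>
    almost_contact_metric \<A> \<phi> \<xi> \<eta> g \<and>
    smooth_fun \<A> f \<and> (\<forall>p. f p > 0) \<and>
    kenmotsu \<A> \<phi> (conf_xi f \<xi>) (conf_eta f \<eta>) (conf_metric f g)"

definition conformal_kenmotsu_space_form ::
  "nat \<Rightarrow> ('m::{t2_space,second_countable_topology}, 'e::euclidean_space) chart set \<Rightarrow>
   ('m \<Rightarrow> 'm tvec \<Rightarrow> 'm tvec) \<Rightarrow> 'm vfield \<Rightarrow> ('m \<Rightarrow> 'm tvec \<Rightarrow> real) \<Rightarrow> 'm metric \<Rightarrow>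
   ('m \<Rightarrow> real) \<Rightarrow> real \<Rightarrow> bool"
  where "conformal_kenmotsu_space_form n \<A> \<phi> \<xi> \<eta> g f c \<longleftrightarrow>
    conformal_kenmotsu n \<A> \<phi> \<xi> \<eta> g f \<and>
    phi_sectional_curvature_const \<A> \<phi> (conf_xi f \<xi>) (conf_metric f g) c"

definition lee_form :: "('m \<Rightarrow> real) \<Rightarrow> 'm \<Rightarrow> 'm tvec \<Rightarrow> real"
  where "lee_form f p v = v f"

definition is_sharp ::
  "('m, 'e::euclidean_space) chart set \<Rightarrow> 'm metric \<Rightarrow> ('m \<Rightarrow> 'm tvec \<Rightarrow> real) \<Rightarrow> 'm vfield \<Rightarrow> bool"
  where "is_sharp \<A> g \<omega> W \<longleftrightarrow>
    vector_field \<A> W \<and> (\<forall>p. \<forall>v\<in>tangent_space \<A> p. g p (W p) v = \<omega> p v)"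


subsection \<open>Embedded submanifolds\<close>

definition slice_chart ::
  "('m::topological_space, 'e::euclidean_space) chart set \<Rightarrow> nat \<Rightarrow> 'm set \<Rightarrow>
   ('m, 'e) chart \<Rightarrow> 'e set \<Rightarrow> bool"
  where "slice_chart \<A> k S c L \<longleftrightarrow> c \<in> max_atlas \<A> \<and> subspace L \<and> dim L = k \<and>
    snd c ` (S \<inter> fst c) = snd c ` fst c \<inter> L"

definition embedded_submanifold ::
  "('m::topological_space, 'e::euclidean_space) chart set \<Rightarrow> nat \<Rightarrow> 'm set \<Rightarrow> bool"
  where "embedded_submanifold \<A> k S \<longleftrightarrow> (\<forall>p\<in>S. \<exists>c L. slice_chart \<A> k S c L \<and> p \<in> fst c)"

text \<open>The tangent space of the embedded \<open>k\<close>-dimensional submanifold \<open>S\<close> at \<open>p\<close>, as a subspace of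
  the tangent space of the ambient manifold.\<close>

definition tangent_sub ::
  "('m::topological_space, 'e::euclidean_space) chart set \<Rightarrow> nat \<Rightarrow> 'm set \<Rightarrow> 'm \<Rightarrow> 'm tvec set"
  where "tangent_sub \<A> k S p =
    {dir_deriv \<A> c p e | c L e. slice_chart \<A> k S c L \<and> p \<in> fst c \<and> e \<in> L}"

definition normal_sub ::
  "('m::topological_space, 'e::euclidean_space) chart set \<Rightarrow> nat \<Rightarrow> 'm metric \<Rightarrow> 'm set \<Rightarrow>
   'm \<Rightarrow> 'm tvec set"
  where "normal_sub \<A> k g S p =
    {v \<in> tangent_space \<A> p. \<forall>w\<in>tangent_sub \<A> k S p. g p v w = 0}"

text \<open>Vector fields along \<open>S\<close> are total functions of which only the values on \<open>S\<close> matter.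
  \<open>extends_near \<A> S p X X'\<close>: the smooth vector field \<open>X'\<close> on the ambient manifold coincides with
  \<open>X\<close> on the part of \<open>S\<close> in a neighbourhood of \<open>p\<close>.\<close>

definition extends_near ::
  "('m::topological_space, 'e::euclidean_space) chart set \<Rightarrow> 'm set \<Rightarrow> 'm \<Rightarrow>
   'm vfield \<Rightarrow> 'm vfield \<Rightarrow> bool"
  where "extends_near \<A> S p X X' \<longleftrightarrow>
    vector_field \<A> X' \<and> (\<exists>V. open V \<and> p \<in> V \<and> (\<forall>q\<in>S \<inter> V. X' q = X q))"

definition field_along ::
  "('m::topological_space, 'e::euclidean_space) chart set \<Rightarrow> 'm set \<Rightarrow> 'm vfield \<Rightarrow> bool"
  where "field_along \<A> S X \<longleftrightarrow> (\<forall>p\<in>S. \<exists>X'. extends_near \<A> S p X X')"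

definition tangent_field ::
  "('m::topological_space, 'e::euclidean_space) chart set \<Rightarrow> nat \<Rightarrow> 'm set \<Rightarrow> 'm vfield \<Rightarrow> bool"
  where "tangent_field \<A> k S X \<longleftrightarrow>
    field_along \<A> S X \<and> (\<forall>p\<in>S. X p \<in> tangent_sub \<A> k S p)"

definition unit_normal_field ::
  "('m::topological_space, 'e::euclidean_space) chart set \<Rightarrow> nat \<Rightarrow> 'm metric \<Rightarrow> 'm set \<Rightarrow>
   'm vfield \<Rightarrow> bool"
  where "unit_normal_field \<A> k g S N \<longleftrightarrow>
    field_along \<A> S N \<and> (\<forall>p\<in>S. N p \<in> normal_sub \<A> k g S p \<and> g p (N p) (N p) = 1)"

text \<open>Covariant derivative, in a direction \<open>v\<close> tangent to \<open>S\<close>, of a vector field given along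
  \<open>S\<close> only, and Lie bracket of vector fields tangent to \<open>S\<close>.  Both are independent of the chosen
  local extensions.\<close>

definition nabla_along ::
  "('m::topological_space, 'e::euclidean_space) chart set \<Rightarrow> 'm connection \<Rightarrow> 'm set \<Rightarrow> 'm connection"
  where "nabla_along \<A> nab S p v Y = (THE w. \<exists>Y'. extends_near \<A> S p Y Y' \<and> w = nab p v Y')"

definition bracket_on ::
  "('m::topological_space, 'e::euclidean_space) chart set \<Rightarrow> 'm set \<Rightarrow>
   'm vfield \<Rightarrow> 'm vfield \<Rightarrow> 'm vfield"
  where "bracket_on \<A> S X Y p =
    (THE w. \<exists>X' Y'. extends_near \<A> S p X X' \<and> extends_near \<A> S p Y Y' \<and> w = lie_bracket X' Y' p)"

definition shape_operator ::
  "('m::topological_space, 'e::euclidean_space) chart set \<Rightarrow> 'm connection \<Rightarrow> 'm set \<Rightarrow>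
   'm vfield \<Rightarrow> 'm \<Rightarrow> 'm tvec \<Rightarrow> 'm tvec"
  where "shape_operator \<A> nab S N p v = - nabla_along \<A> nab S p v N"

text \<open>\<open>(L\<^sub>\<xi> A) X = [\<xi>, A X] - A [\<xi>, X]\<close>\<close>

definition lie_derivative ::
  "('m::topological_space, 'e::euclidean_space) chart set \<Rightarrow> 'm set \<Rightarrow> 'm vfield \<Rightarrow>
   ('m \<Rightarrow> 'm tvec \<Rightarrow> 'm tvec) \<Rightarrow> 'm vfield \<Rightarrow> 'm vfield"
  where "lie_derivative \<A> S \<xi> A X p =
    bracket_on \<A> S \<xi> (\<lambda>q. A q (X q)) p - A p (bracket_on \<A> S \<xi> X p)"

definition lie_parallel ::
  "('m::topological_space, 'e::euclidean_space) chart set \<Rightarrow> nat \<Rightarrow> 'm set \<Rightarrow> 'm vfield \<Rightarrow>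
   ('m \<Rightarrow> 'm tvec \<Rightarrow> 'm tvec) \<Rightarrow> bool"
  where "lie_parallel \<A> k S \<xi> A \<longleftrightarrow>
    (\<forall>X. tangent_field \<A> k S X \<longrightarrow> (\<forall>p\<in>S. lie_derivative \<A> S \<xi> A X p = 0))"

definition totally_umbilic ::
  "('m::topological_space, 'e::euclidean_space) chart set \<Rightarrow> nat \<Rightarrow> 'm set \<Rightarrow>
   ('m \<Rightarrow> 'm tvec \<Rightarrow> 'm tvec) \<Rightarrow> bool"
  where "totally_umbilic \<A> k S A \<longleftrightarrow>
    (\<exists>\<mu> :: 'm \<Rightarrow> real. \<forall>p\<in>S. \<forall>v\<in>tangent_sub \<A> k S p. A p v = \<mu> p *\<^sub>R v)"


subsection \<open>CR-hypersurfaces\<close>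

definition distribution ::
  "('m::topological_space, 'e::euclidean_space) chart set \<Rightarrow> nat \<Rightarrow> 'm set \<Rightarrow>
   ('m \<Rightarrow> 'm tvec set) \<Rightarrow> bool"
  where "distribution \<A> k S D \<longleftrightarrow>
    (\<exists>r. \<forall>p\<in>S. \<exists>V E. open V \<and> p \<in> V \<and> (\<forall>i<r. tangent_field \<A> k S (E i)) \<and>
       (\<forall>q\<in>S \<inter> V. D q = span ((\<lambda>i. E i q) ` {..<r}) \<and> dim (D q) = r))"

definition cr_decomposition ::
  "('m::topological_space, 'e::euclidean_space) chart set \<Rightarrow> nat \<Rightarrow>
   ('m \<Rightarrow> 'm tvec \<Rightarrow> 'm tvec) \<Rightarrow> 'm metric \<Rightarrow> 'm set \<Rightarrow>
   ('m \<Rightarrow> 'm tvec set) \<Rightarrow> ('m \<Rightarrow> 'm tvec set) \<Rightarrow> bool"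
  where "cr_decomposition \<A> k \<phi> g S D D' \<longleftrightarrow>
    distribution \<A> k S D \<and> distribution \<A> k S D' \<and>
    (\<forall>p\<in>S.
       tangent_sub \<A> k S p = {u + v | u v. u \<in> D p \<and> v \<in> D' p} \<and>
       (\<forall>u\<in>D p. \<forall>v\<in>D' p. g p u v = 0) \<and>
       \<phi> p ` D p \<subseteq> D p \<and> \<phi> p ` D' p \<subseteq> normal_sub \<A> k g S p)"

text \<open>The decomposition is the one with \<open>D' = span {U, \<xi>}\<close>, \<open>U = - \<phi> N\<close>, and \<open>D\<close> the orthogonal
  complement of \<open>D'\<close> in the tangent bundle of \<open>S\<close>.\<close>

definition cr_hypersurface ::
  "nat \<Rightarrow> ('m::topological_space, 'e::euclidean_space) chart set \<Rightarrow>
   ('m \<Rightarrow> 'm tvec \<Rightarrow> 'm tvec) \<Rightarrow> 'm vfield \<Rightarrow> 'm metric \<Rightarrow> 'm set \<Rightarrow> 'm vfield \<Rightarrow> bool"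
  where "cr_hypersurface n \<A> \<phi> \<xi> g S N \<longleftrightarrow>
    embedded_submanifold \<A> (2 * n) S \<and>
    unit_normal_field \<A> (2 * n) g S N \<and>
    (\<forall>p\<in>S. \<xi> p \<in> tangent_sub \<A> (2 * n) S p) \<and>
    (\<exists>D D'. cr_decomposition \<A> (2 * n) \<phi> g S D D' \<and>
       (\<forall>p\<in>S. D' p = span {- \<phi> p (N p), \<xi> p} \<and>
          D p = {v \<in> tangent_sub \<A> (2 * n) S p. \<forall>w\<in>D' p. g p v w = 0}))"

end

theory Submission
  imports Defs
begin

text \<open>
Write \<open>l = exp (f/2)\<close>, \<open>u = \<xi> f\<close> and \<open>h X Y = g (\<nabla>\<^sub>X W, Y)\<close>, the Hessian of \<open>f\<close>; on \<open>S\<close> the shape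
operator is \<open>- \<nabla> W\<close>, and \<open>L\<^sub>W g = 2 h\<close>.  The Kenmotsu identity gives \<open>\<nabla>\<xi>\<close> for the conformal metric, and
by the conformal change \<open>L\<^sub>\<xi> g\<close> and \<open>d\<eta>\<close> are explicit expressions in \<open>l\<close>, \<open>u\<close>, \<open>g\<close>, \<open>\<eta>\<close> and \<open>df\<close>.  The
identity \<open>L\<^sub>\<xi> L\<^sub>W g - L\<^sub>W L\<^sub>\<xi> g = L\<^bsub>[\<xi>,W]\<^esub> g\<close> takes the place of the Codazzi equation.  On vectors tangent
to \<open>S\<close>, where \<open>u = 0\<close>, \<open>df = 0\<close> and \<open>W u = l\<close>, Lie parallelism turns the first term into
\<open>4 l h + 2 l \<eta>\<otimes>\<eta>\<close>, while the other two terms are \<open>4 l h + l \<eta>\<otimes>\<eta>\<close> and \<open>- 2 l h - l (g - \<eta>\<otimes>\<eta>)\<close>.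
Hence \<open>h = - g / 2\<close>, so the shape operator is half the identity.
\<close>

subsection \<open>Smooth functions and charts\<close>

text \<open>Since \<open>U\<close> is open, a full derivative at a point of \<open>U\<close> sees
  only values near that point in \<open>U\<close>. The derivatives thus agree on \<open>U\<close>
  again, so the induction has to vary both functions.\<close>

lemma Ck_on_cong:
  assumes "open U" "\<And>x. x \<in> U \<Longrightarrow> f x = g x" "Ck_on k f U"
  shows "Ck_on k g U"
  using assms(2,3)
proof (induction k arbitrary: f g)
  case 0
  then show ?case using continuous_on_cong by (metis Ck_on.simps(1))
next
  case (Suc k)
  have d: "(g has_derivative frechet_derivative f (at x)) (at x)" if "x \<in> U" for x
  proof (rule has_derivative_transform_within_open[OF _ assms(1) that])
    show "(f has_derivative frechet_derivative f (at x)) (at x)"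
      using Suc.prems(2) that by (simp add: frechet_derivative_works)
  qed (use Suc.prems in auto)
  have e: "frechet_derivative f (at x) = frechet_derivative g (at x)" if "x \<in> U" for x
    using d[OF that] frechet_derivative_at by blast
  have "Ck_on k (\<lambda>x. frechet_derivative g (at x) v) U" for v
    by (rule Suc.IH[of "\<lambda>x. frechet_derivative f (at x) v"]) (use e Suc.prems in auto)
  then show ?case using d by (auto simp: differentiable_def)
qed

lemma Ck_on_Suc_imp: "Ck_on (Suc k) f U \<Longrightarrow> Ck_on k f U"
proof (induction k arbitrary: f)
  case 0
  then show ?case
    by (auto intro!: continuous_at_imp_continuous_on differentiable_imp_continuous_within)
qed auto

lemma Ck_on_const: "Ck_on k (\<lambda>x. a) U"
  by (induction k arbitrary: a) (simp_all add: frechet_derivative_const)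

lemma Ck_on_add:
  assumes "open U" "Ck_on k f U" "Ck_on k g U"
  shows "Ck_on k (\<lambda>x. f x + g x) U"
  using assms(2,3)
proof (induction k arbitrary: f g)
  case (Suc k)
  have e: "frechet_derivative (\<lambda>x. f x + g x) (at x) v =
       frechet_derivative f (at x) v + frechet_derivative g (at x) v" if "x \<in> U" for x v
  proof -
    have "((\<lambda>x. f x + g x) has_derivative
       (\<lambda>v. frechet_derivative f (at x) v + frechet_derivative g (at x) v)) (at x)"
      using Suc.prems that by (intro has_derivative_add) (auto simp: frechet_derivative_works[symmetric])
    from fun_cong[OF frechet_derivative_at[OF this], of v] show ?thesis by simp
  qed
  have "Ck_on k (\<lambda>x. frechet_derivative (\<lambda>x. f x + g x) (at x) v) U" for v
    by (rule Ck_on_cong[OF assms(1) _ Suc.IH[of "\<lambda>x. frechet_derivative f (at x) v"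
            "\<lambda>x. frechet_derivative g (at x) v"]])
      (use Suc.prems in \<open>auto simp: e\<close>)
  then show ?case using Suc.prems by auto
qed (simp add: continuous_on_add)

lemma Ck_on_mult:
  fixes f g :: "'a::real_normed_vector \<Rightarrow> real"
  assumes "open U" "Ck_on k f U" "Ck_on k g U"
  shows "Ck_on k (\<lambda>x. f x * g x) U"
  using assms(2,3)
proof (induction k arbitrary: f g)
  case (Suc k)
  have D: "((\<lambda>x. f x * g x) has_derivative
       (\<lambda>v. f x * frechet_derivative g (at x) v + frechet_derivative f (at x) v * g x)) (at x)"
    if "x \<in> U" for x
    using Suc.prems that by (intro has_derivative_mult) (auto simp: frechet_derivative_works[symmetric])
  have e: "frechet_derivative (\<lambda>x. f x * g x) (at x) v =
       f x * frechet_derivative g (at x) v + frechet_derivative f (at x) v * g x"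
    if "x \<in> U" for x v
    using frechet_derivative_at[OF D[OF that]] by metis
  have "Ck_on k (\<lambda>x. f x * frechet_derivative g (at x) v + frechet_derivative f (at x) v * g x) U" for v
    using Suc.prems Ck_on_Suc_imp[OF Suc.prems(1)] Ck_on_Suc_imp[OF Suc.prems(2)]
    by (intro Ck_on_add[OF assms(1)] Suc.IH) auto
  then have "Ck_on k (\<lambda>x. frechet_derivative (\<lambda>x. f x * g x) (at x) v) U" for v
    by (rule Ck_on_cong[OF assms(1), rotated]) (simp add: e)
  then show ?case using D by (auto simp: differentiable_def)
qed (simp add: continuous_on_mult)

section \<open>Change of charts\<close>

lemma chart_inv_left: "is_chart c \<Longrightarrow> p \<in> fst c \<Longrightarrow> chart_inv c (snd c p) = p"
  by (auto simp: is_chart_def homeomorphism_def)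

lemma open_chart_preimage:
  assumes "is_chart c" "open V"
  shows "open {x \<in> snd c ` fst c. chart_inv c x \<in> V}"
proof -
  have "continuous_on (snd c ` fst c) (chart_inv c)" "open (snd c ` fst c)"
    using assms by (auto simp: is_chart_def homeomorphism_def)
  from continuous_open_preimage[OF this assms(2)] show ?thesis
    by (simp add: vimage_def Collect_conj_eq)
qed

text \<open>Chain rule for the transition map. Differentiability of \<open>h\<close> is assumed in
  the chart \<open>d\<close> and obtained in \<open>c\<close>; this later admits slice charts, which
  come from the maximal atlas.\<close>

lemma has_derivative_chart_change:
  fixes h :: "'m::topological_space \<Rightarrow> real"
    and c d :: "('m, 'e::euclidean_space) chart"
  assumes c: "is_chart c" and d: "is_chart d" and cd: "compatible c d"
    and p: "p \<in> fst c" "p \<in> fst d"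
    and h: "(h \<circ> chart_inv d) differentiable at (snd d p)"
  shows "(h \<circ> chart_inv c has_derivative
      (\<lambda>e. frechet_derivative (h \<circ> chart_inv d) (at (snd d p))
        (frechet_derivative (snd d \<circ> chart_inv c) (at (snd c p)) e))) (at (snd c p))"
proof -
  let ?U = "{x \<in> snd c ` fst c. chart_inv c x \<in> fst d}"
  have U: "open ?U" using c d by (intro open_chart_preimage) (auto simp: is_chart_def)
  have "Ck_on (Suc 0) (snd d \<circ> chart_inv c) (snd c ` (fst c \<inter> fst d))"
    using cd unfolding compatible_def smooth_on_def by blast
  then have "(snd d \<circ> chart_inv c) differentiable at (snd c p)" using p by auto
  then have "(snd d \<circ> chart_inv c has_derivative
      frechet_derivative (snd d \<circ> chart_inv c) (at (snd c p))) (at (snd c p))"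
    by (simp add: frechet_derivative_works)
  moreover have "(h \<circ> chart_inv d has_derivative frechet_derivative (h \<circ> chart_inv d) (at (snd d p)))
      (at ((snd d \<circ> chart_inv c) (snd c p)))"
    using h c p by (simp add: frechet_derivative_works chart_inv_left)
  ultimately have "((h \<circ> chart_inv d) \<circ> (snd d \<circ> chart_inv c) has_derivative
      frechet_derivative (h \<circ> chart_inv d) (at (snd d p)) \<circ>
      frechet_derivative (snd d \<circ> chart_inv c) (at (snd c p))) (at (snd c p))"
    by (rule diff_chain_at)
  then show ?thesis unfolding o_def[of "frechet_derivative _ _"]
    by (rule has_derivative_transform_within_open[OF _ U])
      (use c d p in \<open>auto simp: chart_inv_left\<close>)
qed

subsection \<open>Tangent vectors as derivations\<close>

locale smooth_manifold =
  fixes \<A> :: "('m::{t2_space,second_countable_topology}, 'e::euclidean_space) chart set"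
  assumes atlas: "smooth_atlas \<A>"
begin

abbreviation "T \<equiv> tangent_space \<A>"
abbreviation "VF \<equiv> vector_field \<A>"
abbreviation "SF \<equiv> smooth_fun \<A>"

lemma is_chart: "c \<in> \<A> \<Longrightarrow> is_chart c"
  and compatible: "c \<in> \<A> \<Longrightarrow> d \<in> \<A> \<Longrightarrow> compatible c d"
  using atlas by (auto simp: smooth_atlas_def)

lemma chart_at: obtains c where "c \<in> \<A>" "p \<in> fst c"
  using atlas by (fastforce simp: smooth_atlas_def)

lemma max_atlasD: "c \<in> max_atlas \<A> \<Longrightarrow> is_chart c"
  "c \<in> max_atlas \<A> \<Longrightarrow> d \<in> \<A> \<Longrightarrow> compatible c d"
  by (auto simp: max_atlas_def)

lemma atlas_subset: "c \<in> \<A> \<Longrightarrow> c \<in> max_atlas \<A>"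
  by (auto simp: max_atlas_def is_chart compatible)

section \<open>Algebra of smooth functions\<close>

lemma smooth_const: "SF (\<lambda>p. a)"
  by (auto simp: smooth_fun_def smooth_on_def o_def Ck_on_const)

lemma smooth_add: "SF h \<Longrightarrow> SF k \<Longrightarrow> SF (\<lambda>p. h p + k p)"
  using is_chart by (auto simp: smooth_fun_def smooth_on_def o_def is_chart_def intro!: Ck_on_add)

lemma smooth_mult: "SF h \<Longrightarrow> SF k \<Longrightarrow> SF (\<lambda>p. h p * k p)"
  using is_chart by (auto simp: smooth_fun_def smooth_on_def o_def is_chart_def intro!: Ck_on_mult)

lemma smooth_diff: "SF h \<Longrightarrow> SF k \<Longrightarrow> SF (\<lambda>p. h p - k p)"
  using smooth_add[OF _ smooth_mult[OF smooth_const[of "-1"]], of h k] by simp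

lemma smooth_minus: "SF h \<Longrightarrow> SF (\<lambda>p. - h p)"
  using smooth_mult[OF smooth_const[of "-1"]] by simp

text \<open>\<open>smooth_fun\<close> tests only charts of the atlas, while slice charts belong to
  the maximal atlas; the chain rule carries differentiability over.\<close>

lemma differentiable_chart:
  assumes "SF h" "c \<in> max_atlas \<A>" "p \<in> fst c"
  shows "(h \<circ> chart_inv c) differentiable at (snd c p)"
proof -
  obtain d where d: "d \<in> \<A>" "p \<in> fst d" by (rule chart_at)
  have "Ck_on (Suc 0) (h \<circ> chart_inv d) (snd d ` fst d)"
    using assms(1) d unfolding smooth_fun_def smooth_on_def by blast
  then have "(h \<circ> chart_inv d) differentiable at (snd d p)" using d by auto
  from has_derivative_chart_change[OF _ _ _ assms(3) d(2) this] show ?thesis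
    using assms d max_atlasD is_chart by (auto simp: differentiable_def)
qed

lemma dir_deriv_add:
  assumes "c \<in> max_atlas \<A>" "p \<in> fst c"
  shows "dir_deriv \<A> c p (x + y) = dir_deriv \<A> c p x + dir_deriv \<A> c p y"
  using linear_frechet_derivative[OF differentiable_chart[OF _ assms]]
  by (auto simp: dir_deriv_def fun_eq_iff linear_add)

lemma dir_deriv_scaleR:
  assumes "c \<in> max_atlas \<A>" "p \<in> fst c"
  shows "dir_deriv \<A> c p (r *\<^sub>R x) = r *\<^sub>R dir_deriv \<A> c p x"
  using linear_frechet_derivative[OF differentiable_chart[OF _ assms]]
  by (auto simp: dir_deriv_def fun_eq_iff scaleR_fun_def linear_scale)

lemma dir_deriv_chart_change:
  assumes "c \<in> max_atlas \<A>" "p \<in> fst c" "d \<in> max_atlas \<A>" "p \<in> fst d" "compatible c d"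
  shows "dir_deriv \<A> c p e =
    dir_deriv \<A> d p (frechet_derivative (snd d \<circ> chart_inv c) (at (snd c p)) e)"
proof
  fix h
  show "dir_deriv \<A> c p e h =
    dir_deriv \<A> d p (frechet_derivative (snd d \<circ> chart_inv c) (at (snd c p)) e) h"
  proof (cases "SF h")
    case True
    from has_derivative_chart_change[OF _ _ assms(5,2,4) differentiable_chart[OF True assms(3,4)]]
    show ?thesis using assms max_atlasD True
      by (simp add: dir_deriv_def frechet_derivative_at[symmetric])
  qed (simp add: dir_deriv_def)
qed

text \<open>The Jacobian of a transition map turns coordinate derivatives of any chart into those of
  \<open>c\<close>, so a single chart sees the whole union in \<open>tangent_space\<close>. This
  makes the tangent space a linear image of the model space.\<close>

lemma tangent_space_eq_range:
  assumes "c \<in> max_atlas \<A>" "p \<in> fst c"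
  shows "T p = range (dir_deriv \<A> c p)"
proof -
  have cd: "dir_deriv \<A> d p e \<in> range (dir_deriv \<A> c p)" if "d \<in> \<A>" "p \<in> fst d" for d e
  proof -
    have "compatible d c" using max_atlasD(2)[OF assms(1) that(1)] by (auto simp: compatible_def Int_commute)
    from dir_deriv_chart_change[OF atlas_subset[OF that(1)] that(2) assms this, of e] show ?thesis by simp
  qed
  obtain d where d: "d \<in> \<A>" "p \<in> fst d" by (rule chart_at)
  have "dir_deriv \<A> c p e \<in> T p" for e
    unfolding tangent_space_def
      dir_deriv_chart_change[OF assms atlas_subset[OF d(1)] d(2) max_atlasD(2)[OF assms(1) d(1)], of e]
    using d by blast
  then show ?thesis using cd by (auto simp: tangent_space_def)
qed

lemma subspace_tangent_space: "subspace (T p)"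
proof -
  obtain c where c: "c \<in> \<A>" "p \<in> fst c" by (rule chart_at)
  note c' = atlas_subset[OF c(1)] c(2)
  have "linear (dir_deriv \<A> c p)"
    by (rule linearI) (simp_all add: dir_deriv_add[OF c'] dir_deriv_scaleR[OF c'])
  then show ?thesis unfolding tangent_space_eq_range[OF c']
    by (intro linear_subspace_image subspace_UNIV)
qed

lemmas T_add = subspace_add[OF subspace_tangent_space]
  and T_diff = subspace_diff[OF subspace_tangent_space]
  and T_minus = subspace_neg[OF subspace_tangent_space]
  and T_scale = subspace_scale[OF subspace_tangent_space]
  and T_zero = subspace_0[OF subspace_tangent_space]
lemmas T_intros = T_add T_diff T_minus T_scale T_zero

lemma T_nonsmooth: "v \<in> T p \<Longrightarrow> \<not> SF h \<Longrightarrow> v h = 0"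
  by (auto simp: tangent_space_def dir_deriv_def)

lemma tangent_cases:
  assumes "v \<in> T p"
  obtains c e where "c \<in> \<A>" "p \<in> fst c" "chart_inv c (snd c p) = p"
    "\<And>h. SF h \<Longrightarrow> (h \<circ> chart_inv c has_derivative frechet_derivative (h \<circ> chart_inv c) (at (snd c p))) (at (snd c p))"
    "\<And>h. SF h \<Longrightarrow> v h = frechet_derivative (h \<circ> chart_inv c) (at (snd c p)) e"
proof -
  from assms obtain c e where c: "c \<in> \<A>" "p \<in> fst c" "v = dir_deriv \<A> c p e"
    by (auto simp: tangent_space_def)
  show ?thesis
    by (rule that[OF c(1,2) chart_inv_left[OF is_chart[OF c(1)] c(2)], of e])
      (use differentiable_chart[OF _ atlas_subset[OF c(1)] c(2)] c in
        \<open>auto simp: frechet_derivative_works dir_deriv_def\<close>)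
qed

lemma T_fun_add:
  assumes "v \<in> T p" "SF h" "SF k"
  shows "v (\<lambda>q. h q + k q) = v h + v k"
proof (rule tangent_cases[OF assms(1)])
  fix c e
  assume D: "\<And>h. SF h \<Longrightarrow> (h \<circ> chart_inv c has_derivative frechet_derivative (h \<circ> chart_inv c) (at (snd c p))) (at (snd c p))"
    and v: "\<And>h. SF h \<Longrightarrow> v h = frechet_derivative (h \<circ> chart_inv c) (at (snd c p)) e"
  from fun_cong[OF frechet_derivative_at[OF has_derivative_add[OF D[OF assms(2)] D[OF assms(3)]]], of e]
  show ?thesis
    using v[OF smooth_add[OF assms(2,3)]] v[OF assms(2)] v[OF assms(3)] by (simp add: o_def)
qed

lemma T_fun_mult:
  assumes "v \<in> T p" "SF h" "SF k"
  shows "v (\<lambda>q. h q * k q) = v h * k p + h p * v k"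
proof (rule tangent_cases[OF assms(1)])
  fix c e
  assume c: "chart_inv c (snd c p) = p"
    and D: "\<And>h. SF h \<Longrightarrow> (h \<circ> chart_inv c has_derivative frechet_derivative (h \<circ> chart_inv c) (at (snd c p))) (at (snd c p))"
    and v: "\<And>h. SF h \<Longrightarrow> v h = frechet_derivative (h \<circ> chart_inv c) (at (snd c p)) e"
  from fun_cong[OF frechet_derivative_at[OF has_derivative_mult[OF D[OF assms(2)] D[OF assms(3)]]], of e]
  show ?thesis
    using v[OF smooth_mult[OF assms(2,3)]] v[OF assms(2)] v[OF assms(3)] c by (simp add: o_def)
qed

lemma T_fun_const:
  assumes "v \<in> T p"
  shows "v (\<lambda>q. a) = 0"
proof (rule tangent_cases[OF assms(1)])
  fix c e
  assume v: "\<And>h. SF h \<Longrightarrow> v h = frechet_derivative (h \<circ> chart_inv c) (at (snd c p)) e"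
  show ?thesis using v[OF smooth_const] by (simp add: o_def frechet_derivative_const)
qed

lemma T_fun_cmult: "v \<in> T p \<Longrightarrow> SF h \<Longrightarrow> v (\<lambda>q. a * h q) = a * v h"
  by (simp add: T_fun_mult[OF _ smooth_const] T_fun_const)

lemma T_fun_minus: "v \<in> T p \<Longrightarrow> SF h \<Longrightarrow> v (\<lambda>q. - h q) = - v h"
  using T_fun_cmult[of v p h "-1"] by simp

lemma T_fun_diff: "v \<in> T p \<Longrightarrow> SF h \<Longrightarrow> SF k \<Longrightarrow> v (\<lambda>q. h q - k q) = v h - v k"
  using T_fun_add[of v p h "\<lambda>q. - k q"] T_fun_minus[of v p k] smooth_minus[of k] by simp

lemma T_fun_exp:
  assumes "v \<in> T p" "SF h" "SF (\<lambda>q. exp (a * h q))"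
  shows "v (\<lambda>q. exp (a * h q)) = a * exp (a * h p) * v h"
proof (rule tangent_cases[OF assms(1)])
  fix c e
  assume c: "chart_inv c (snd c p) = p"
    and D: "\<And>h. SF h \<Longrightarrow> (h \<circ> chart_inv c has_derivative frechet_derivative (h \<circ> chart_inv c) (at (snd c p))) (at (snd c p))"
    and v: "\<And>h. SF h \<Longrightarrow> v h = frechet_derivative (h \<circ> chart_inv c) (at (snd c p)) e"
  have "((\<lambda>x. exp (a * (h \<circ> chart_inv c) x)) has_derivative
      (\<lambda>y. exp (a * (h \<circ> chart_inv c) (snd c p)) *
        (a * frechet_derivative (h \<circ> chart_inv c) (at (snd c p)) y))) (at (snd c p))"
    by (rule derivative_eq_intros D[OF assms(2)] refl | simp add: fun_eq_iff)+
  from fun_cong[OF frechet_derivative_at[OF this], of e] show ?thesis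
    using v[OF assms(3)] v[OF assms(2)] c by (simp add: o_def mult_ac)
qed

section \<open>Vector fields and Lie brackets\<close>

lemma VF_T: "VF X \<Longrightarrow> X p \<in> T p"
  and VF_smooth: "VF X \<Longrightarrow> SF h \<Longrightarrow> SF (\<lambda>p. X p h)"
  by (auto simp: vector_field_def)

lemma VF_add: "VF X \<Longrightarrow> VF Y \<Longrightarrow> VF (\<lambda>p. X p + Y p)"
  by (auto simp: vector_field_def T_intros smooth_add)

lemma VF_scale: "VF X \<Longrightarrow> VF (\<lambda>p. a *\<^sub>R X p)"
  by (simp add: vector_field_def T_intros) (simp add: scaleR_fun_def smooth_mult smooth_const)

lemma VF_diff: "VF X \<Longrightarrow> VF Y \<Longrightarrow> VF (\<lambda>p. X p - Y p)"
  by (auto simp: vector_field_def T_intros smooth_diff)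

lemma VF_minus: "VF X \<Longrightarrow> VF (\<lambda>p. - X p)"
  by (auto simp: vector_field_def T_intros smooth_minus)

lemma VF_zero: "VF (\<lambda>p. 0)"
  by (auto simp: vector_field_def T_intros smooth_const)

lemma VF_nonsmooth: "VF X \<Longrightarrow> \<not> SF h \<Longrightarrow> (\<lambda>q. X q h) = (\<lambda>q. 0)"
  using T_nonsmooth VF_T by fastforce

lemma lie_bracket_minus:
  assumes "VF X" "VF Y"
  shows "lie_bracket X (\<lambda>q. - Y q) p = - lie_bracket X Y p"
proof
  fix h
  show "lie_bracket X (\<lambda>q. - Y q) p h = (- lie_bracket X Y p) h"
  proof (cases "SF h")
    case True
    then show ?thesis
      using T_fun_minus[OF VF_T[OF assms(1)] VF_smooth[OF assms(2) True], of p]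
      by (simp add: lie_bracket_def)
  next
    case False
    then show ?thesis
      using assms by (simp add: lie_bracket_def VF_nonsmooth T_nonsmooth[OF VF_T] T_fun_const[OF VF_T[OF assms(1)]])
  qed
qed

text \<open>On a smooth function both sides expand to the same iterated derivatives. Fields are
  operators on all functions, so functions that are not smooth are checked separately; there every
  term is zero by convention.\<close>

lemma lie_bracket_jacobi:
  assumes "VF X" "VF Y" "VF Z"
  shows "lie_bracket (lie_bracket X Y) Z p =
    lie_bracket X (lie_bracket Y Z) p - lie_bracket Y (lie_bracket X Z) p"
proof
  fix h
  show "lie_bracket (lie_bracket X Y) Z p h =
    (lie_bracket X (lie_bracket Y Z) p - lie_bracket Y (lie_bracket X Z) p) h"
  proof (cases "SF h")
    case True
    then show ?thesis using assms
      by (simp add: lie_bracket_def T_fun_diff[OF assms(1)[THEN VF_T]]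
          T_fun_diff[OF assms(2)[THEN VF_T]] T_fun_diff[OF assms(3)[THEN VF_T]] VF_smooth)
  next
    case False
    then show ?thesis using assms
      by (simp add: lie_bracket_def VF_nonsmooth T_fun_const[OF assms(1)[THEN VF_T]]
          T_fun_const[OF assms(2)[THEN VF_T]] T_fun_const[OF assms(3)[THEN VF_T]])
  qed
qed

end

subsection \<open>Lie derivatives of the metric\<close>

locale riemannian_manifold = smooth_manifold \<A>
  for \<A> :: "('m::{t2_space,second_countable_topology}, 'e::euclidean_space) chart set" +
  fixes g :: "'m metric" and nab :: "'m connection"
  assumes metric: "riemannian_metric \<A> g" and lc: "levi_civita \<A> g nab"
begin

lemma g_smooth: "VF X \<Longrightarrow> VF Y \<Longrightarrow> SF (\<lambda>p. g p (X p) (Y p))"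
  using metric by (auto simp: riemannian_metric_def)

lemma g_sym: "u \<in> T p \<Longrightarrow> v \<in> T p \<Longrightarrow> g p u v = g p v u"
  using metric by (auto simp: riemannian_metric_def)

lemma g_lin: "u \<in> T p \<Longrightarrow> v \<in> T p \<Longrightarrow> w \<in> T p \<Longrightarrow>
    g p u (a *\<^sub>R v + b *\<^sub>R w) = a * g p u v + b * g p u w"
  using metric by (auto simp: riemannian_metric_def lin_on_def)

lemma g_eq_0: "u \<in> T p \<Longrightarrow> g p u u = 0 \<Longrightarrow> u = 0"
  using metric by (fastforce simp: riemannian_metric_def)

lemma g_add_right: "u \<in> T p \<Longrightarrow> v \<in> T p \<Longrightarrow> w \<in> T p \<Longrightarrow> g p u (v + w) = g p u v + g p u w"
  using g_lin[of u p v w 1 1] by simp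

lemma g_diff_right: "u \<in> T p \<Longrightarrow> v \<in> T p \<Longrightarrow> w \<in> T p \<Longrightarrow> g p u (v - w) = g p u v - g p u w"
  using g_lin[of u p v w 1 "-1"] by simp

lemma g_scale_right: "u \<in> T p \<Longrightarrow> v \<in> T p \<Longrightarrow> g p u (a *\<^sub>R v) = a * g p u v"
  using g_lin[of u p v v a 0] by simp

lemma g_minus_right: "u \<in> T p \<Longrightarrow> v \<in> T p \<Longrightarrow> g p u (- v) = - g p u v"
  using g_lin[of u p v v "-1" 0] by simp

lemma g_add_left: "u \<in> T p \<Longrightarrow> v \<in> T p \<Longrightarrow> w \<in> T p \<Longrightarrow> g p (v + w) u = g p v u + g p w u"
  using g_add_right g_sym T_add by metis

lemma g_diff_left: "u \<in> T p \<Longrightarrow> v \<in> T p \<Longrightarrow> w \<in> T p \<Longrightarrow> g p (v - w) u = g p v u - g p w u"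
  using g_diff_right g_sym T_diff by metis

lemma g_scale_left: "u \<in> T p \<Longrightarrow> v \<in> T p \<Longrightarrow> g p (a *\<^sub>R v) u = a * g p v u"
  using g_scale_right g_sym T_scale by metis

lemma g_minus_left: "u \<in> T p \<Longrightarrow> v \<in> T p \<Longrightarrow> g p (- v) u = - g p v u"
  using g_minus_right g_sym T_minus by metis

lemmas g_simps = g_add_right g_add_left g_diff_right g_diff_left g_scale_right g_scale_left
  g_minus_right g_minus_left

section \<open>Calculus of the Levi-Civita connection\<close>

lemma affine: "affine_connection \<A> nab"
  using lc by (simp add: levi_civita_def)

lemma nab_VF: "VF X \<Longrightarrow> VF Y \<Longrightarrow> VF (\<lambda>p. nab p (X p) Y)"
  using affine by (simp add: affine_connection_def)

lemma nab_T: "v \<in> T p \<Longrightarrow> VF Y \<Longrightarrow> nab p v Y \<in> T p"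
  using affine by (simp add: affine_connection_def)

lemma nab_leibniz: "v \<in> T p \<Longrightarrow> VF Y \<Longrightarrow> SF h \<Longrightarrow>
    nab p v (\<lambda>q. h q *\<^sub>R Y q) = v h *\<^sub>R Y p + h p *\<^sub>R nab p v Y"
  using affine by (simp add: affine_connection_def)

lemma nab_add: "v \<in> T p \<Longrightarrow> VF Y \<Longrightarrow> VF Z \<Longrightarrow> nab p v (\<lambda>q. Y q + Z q) = nab p v Y + nab p v Z"
  using affine by (simp add: affine_connection_def plus_fun_def)

lemma nab_diff:
  assumes "v \<in> T p" "VF Y" "VF Z"
  shows "nab p v (\<lambda>q. Y q - Z q) = nab p v Y - nab p v Z"
  using nab_add[OF assms(1) VF_diff[OF assms(2,3)] assms(3)] by simp

lemma nab_zero: "v \<in> T p \<Longrightarrow> nab p v (\<lambda>q. 0) = 0"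
  using nab_diff[OF _ VF_zero VF_zero, of v p] by simp

lemma torsion_free: "VF X \<Longrightarrow> VF Y \<Longrightarrow> lie_bracket X Y p = nab p (X p) Y - nab p (Y p) X"
  using lc by (simp add: levi_civita_def)

lemma nab_metric: "v \<in> T p \<Longrightarrow> VF Y \<Longrightarrow> VF Z \<Longrightarrow>
    v (\<lambda>q. g q (Y q) (Z q)) = g p (nab p v Y) (Z p) + g p (Y p) (nab p v Z)"
  using lc by (simp add: levi_civita_def)

text \<open>Torsion-freeness exhibits the bracket as a difference of covariant derivatives, which
  are vector fields by the axioms of a connection; this replaces a computation in
  coordinates.\<close>

lemma lie_bracket_VF: "VF X \<Longrightarrow> VF Y \<Longrightarrow> VF (lie_bracket X Y)"
  using VF_diff[OF nab_VF[of X Y] nab_VF[of Y X]] by (simp flip: torsion_free)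

text \<open>The Lie derivative of the metric along \<open>Z\<close>, evaluated on \<open>X\<close>
  and \<open>Y\<close>. The arguments are fields rather than vectors because the brackets
  differentiate them.\<close>

definition lie_metric :: "'m vfield \<Rightarrow> 'm vfield \<Rightarrow> 'm vfield \<Rightarrow> 'm \<Rightarrow> real"
  where "lie_metric Z X Y p = Z p (\<lambda>q. g q (X q) (Y q)) -
    g p (lie_bracket Z X p) (Y p) - g p (X p) (lie_bracket Z Y p)"

text \<open>Metric compatibility and torsion-freeness cancel the terms that differentiate
  \<open>X\<close> and \<open>Y\<close> along \<open>Z\<close>; the symmetrised covariant derivative
  of \<open>Z\<close> is left.\<close>

lemma lie_metric_nab:
  "VF X \<Longrightarrow> VF Y \<Longrightarrow> VF Z \<Longrightarrow>
    lie_metric Z X Y p = g p (nab p (X p) Z) (Y p) + g p (X p) (nab p (Y p) Z)"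
  by (simp add: lie_metric_def torsion_free nab_metric[of "Z p" p X Y] VF_T nab_T g_simps)

text \<open>Lie derivation turns the bracket of fields into a commutator. The Jacobi identity splits
  the brackets of \<open>lie_bracket V Z\<close> with \<open>X\<close> and with \<open>Y\<close>;
  the mixed terms cancel, and on the function \<open>g (X, Y)\<close> the commutator of
  \<open>V\<close> and \<open>Z\<close> remains.\<close>

lemma lie_metric_commutator:
  assumes "VF V" "VF Z" "VF X" "VF Y"
  shows "V p (lie_metric Z X Y) - lie_metric Z (lie_bracket V X) Y p - lie_metric Z X (lie_bracket V Y) p =
    Z p (lie_metric V X Y) - lie_metric V (lie_bracket Z X) Y p - lie_metric V X (lie_bracket Z Y) p +
    lie_metric (lie_bracket V Z) X Y p"
proof -
  note [simp] = VF_smooth g_smooth lie_bracket_VF smooth_diff VF_T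
  have e: "lie_metric Z X Y = (\<lambda>p. Z p (\<lambda>q. g q (X q) (Y q)) -
    g p (lie_bracket Z X p) (Y p) - g p (X p) (lie_bracket Z Y p))" for X Y Z
    by (simp add: lie_metric_def fun_eq_iff)
  show ?thesis using assms
    unfolding e lie_bracket_jacobi[OF assms(1,2,3)] lie_bracket_jacobi[OF assms(1,2,4)]
    by (simp add: T_fun_diff[OF assms(1)[THEN VF_T]] T_fun_diff[OF assms(2)[THEN VF_T]] g_simps)
      (simp add: lie_bracket_def[of V Z p])
qed

text \<open>Pairing with a gradient gives \<open>X (Y f) - (\<nabla>\<^sub>X Y) f\<close>, and the
  antisymmetric part of this vanishes because the connection has no torsion.\<close>

lemma hessian_sym:
  assumes "VF X" "VF Y" "VF W" "SF f" and W: "\<And>p v. v \<in> T p \<Longrightarrow> g p (W p) v = v f"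
  shows "g p (nab p (X p) W) (Y p) = g p (X p) (nab p (Y p) W)"
proof -
  have "X p (\<lambda>q. Y q f) = g p (nab p (X p) W) (Y p) + nab p (X p) Y f"
    and "Y p (\<lambda>q. X q f) = g p (nab p (Y p) W) (X p) + nab p (Y p) X f"
    using nab_metric[of "X p" p W Y] nab_metric[of "Y p" p W X] assms
    by (simp_all add: VF_T nab_T)
  moreover have "X p (\<lambda>q. Y q f) - Y p (\<lambda>q. X q f) = nab p (X p) Y f - nab p (Y p) X f"
    using fun_cong[OF torsion_free[OF assms(1,2), of p], of f] by (simp add: lie_bracket_def)
  ultimately show ?thesis using assms by (simp add: g_sym[of "X p"] VF_T nab_T)
qed

lemma lie_metric_gradient:
  assumes "VF X" "VF Y" "VF W" "SF f" "\<And>p v. v \<in> T p \<Longrightarrow> g p (W p) v = v f"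
  shows "lie_metric W X Y p = 2 * g p (nab p (X p) W) (Y p)"
  using hessian_sym[OF assms] assms by (simp add: lie_metric_nab)

text \<open>The covariant derivative of \<open>Z\<close> splits into its symmetric part, half of
  \<open>lie_metric Z\<close>, and its antisymmetric part, half of the exterior derivative of the
  1-form dual to \<open>Z\<close>.\<close>

lemma nab_from_lie_metric:
  assumes "VF X" "VF Y" "VF Z"
  shows "2 * g p (nab p (X p) Z) (Y p) = lie_metric Z X Y p +
    (X p (\<lambda>q. g q (Y q) (Z q)) - Y p (\<lambda>q. g q (X q) (Z q)) - g p (lie_bracket X Y p) (Z p))"
  using assms g_sym[of "nab p (X p) Z" p "Y p"]
  by (simp add: lie_metric_nab torsion_free nab_metric[of "X p" p Y Z] nab_metric[of "Y p" p X Z] VF_T nab_T g_simps)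

text \<open>Put \<open>Y = \<xi>\<close> in the Kenmotsu identity: as
  \<open>\<phi> \<xi> = 0\<close>, the vectors \<open>\<nabla>\<^sub>X \<xi>\<close> and
  \<open>X\<close> have the same image under \<open>\<phi>\<close>. Applying \<open>\<phi>\<close>
  once more determines \<open>\<nabla>\<^sub>X \<xi>\<close> up to a multiple of
  \<open>\<xi>\<close>, and the constant length of \<open>\<xi>\<close> fixes that multiple.\<close>

lemma kenmotsu_nab:
  assumes acm: "almost_contact_metric \<A> \<phi> \<xi> \<eta> g"
    and k: "\<And>X Y p. VF X \<Longrightarrow> VF Y \<Longrightarrow> nab p (X p) (\<lambda>q. \<phi> q (Y q)) - \<phi> p (nab p (X p) Y) =
           - (g p (X p) (\<phi> p (Y p)) *\<^sub>R \<xi> p) - \<eta> p (Y p) *\<^sub>R \<phi> p (X p)"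
    and X: "VF X"
  shows "nab p (X p) \<xi> = X p - g p (X p) (\<xi> p) *\<^sub>R \<xi> p"
proof -
  have xi: "VF \<xi>" and eta: "\<And>p v. v \<in> T p \<Longrightarrow> \<eta> p v = g p v (\<xi> p)"
    and phixi: "\<And>p. \<phi> p (\<xi> p) = 0" and unit: "\<And>p. \<eta> p (\<xi> p) = 1"
    and phi2: "\<And>p v. v \<in> T p \<Longrightarrow> \<phi> p (\<phi> p v) = - v + \<eta> p v *\<^sub>R \<xi> p"
    using acm by (auto simp: almost_contact_metric_def)
  have one: "g q (\<xi> q) (\<xi> q) = 1" for q using unit[of q] eta[of "\<xi> q" q] xi by (simp add: VF_T)
  have "nab p (X p) \<xi> \<in> T p" using X xi by (simp add: VF_T nab_T)
  note t = this VF_T[OF X, of p] VF_T[OF xi, of p]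
  have z: "g p (X p) 0 = 0" using g_scale_right[OF t(2,2), of 0] by simp
  have "nab p (X p) (\<lambda>q. \<phi> q (\<xi> q)) = 0" using t by (simp add: phixi nab_zero)
  then have "\<phi> p (nab p (X p) \<xi>) = \<phi> p (X p)"
    using k[OF X xi, of p] unit[of p] by (simp add: phixi z)
  then have "- nab p (X p) \<xi> + \<eta> p (nab p (X p) \<xi>) *\<^sub>R \<xi> p = - X p + \<eta> p (X p) *\<^sub>R \<xi> p"
    using phi2[OF t(1)] phi2[OF t(2)] by simp
  moreover have "\<eta> p (nab p (X p) \<xi>) = 0"
  proof -
    have "0 = g p (nab p (X p) \<xi>) (\<xi> p) + g p (\<xi> p) (nab p (X p) \<xi>)"
      using nab_metric[OF t(2) xi xi] by (simp add: one T_fun_const[OF t(2)])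
    then show ?thesis using t by (simp add: eta g_sym)
  qed
  ultimately show ?thesis using eta[OF t(2)] by (simp add: algebra_simps)
qed

end

subsection \<open>Conformal change of a Kenmotsu structure\<close>

text \<open>The contact structure is represented by \<open>\<xi>\<close>: the 1-form
  \<open>\<eta>\<close> becomes pairing with \<open>\<xi>\<close>, and \<open>conf_nab\<close> is
  the form of the Kenmotsu identity that \<open>kenmotsu_nab\<close> supplies. The field
  \<open>W\<close> is the gradient of \<open>f\<close> for the original metric.\<close>

locale conformal_kenmotsu_manifold = riemannian_manifold \<A> g nab
  for \<A> :: "('m::{t2_space,second_countable_topology}, 'e::euclidean_space) chart set"
    and g :: "'m metric" and nab :: "'m connection" +
  fixes \<xi> W :: "'m vfield" and f :: "'m \<Rightarrow> real" and nab' :: "'m connection"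
  assumes xi: "VF \<xi>" and xi_unit: "g p (\<xi> p) (\<xi> p) = 1"
    and f: "SF f" and W: "VF W" and grad: "v \<in> T p \<Longrightarrow> g p (W p) v = v f"
    and conf_xi: "VF (conf_xi f \<xi>)"
    and conf_metric: "riemannian_metric \<A> (conf_metric f g)"
    and conf_lc: "levi_civita \<A> (conf_metric f g) nab'"
    and conf_nab: "VF X \<Longrightarrow> nab' p (X p) (conf_xi f \<xi>) =
      X p - conf_metric f g p (X p) (conf_xi f \<xi> p) *\<^sub>R conf_xi f \<xi> p"
begin

sublocale conf: riemannian_manifold \<A> "conf_metric f g" nab'
  by unfold_locales (fact conf_metric conf_lc)+

text \<open>The conformal factors are coefficients of the two metrics in \<open>\<xi>\<close>, which gives their smoothness.\<close>

lemma smooth_conf_factors: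
  "SF (\<lambda>q. exp (f q))" "SF (\<lambda>q. exp (f q / 2))" "SF (\<lambda>q. exp (- f q / 2))"
proof -
  have "conf_metric f g q (\<xi> q) (\<xi> q) = exp (f q)" for q
    by (simp add: conf_metric_def xi_unit)
  then show "SF (\<lambda>q. exp (f q))" using conf.g_smooth[OF xi xi] by simp
  have "conf_metric f g q (conf_xi f \<xi> q) (\<xi> q) = exp (f q) * exp (- f q / 2)" for q
    using VF_T[OF xi, of q] by (simp add: conf_metric_def conf_xi_def g_simps xi_unit)
  then have "conf_metric f g q (conf_xi f \<xi> q) (\<xi> q) = exp (f q / 2)" for q
    by (simp flip: exp_add)
  then show "SF (\<lambda>q. exp (f q / 2))" using conf.g_smooth[OF conf_xi xi] by simp
  have "g q (conf_xi f \<xi> q) (\<xi> q) = exp (- f q / 2)" for q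
    using VF_T[OF xi, of q] by (simp add: conf_xi_def g_simps xi_unit)
  then show "SF (\<lambda>q. exp (- f q / 2))" using g_smooth[OF conf_xi xi] by simp
qed

lemma T_fun_conf_factors:
  assumes "v \<in> T p"
  shows "v (\<lambda>q. exp (f q)) = exp (f p) * v f"
    "v (\<lambda>q. exp (f q / 2)) = exp (f p / 2) * v f / 2"
    "v (\<lambda>q. exp (- f q / 2)) = - (exp (- f p / 2) * v f / 2)"
  using T_fun_exp[OF assms f, of 1] T_fun_exp[OF assms f, of "1/2"] T_fun_exp[OF assms f, of "-1/2"]
    smooth_conf_factors by simp_all

lemma exp_half: "exp (f p) = exp (f p / 2) * exp (f p / 2)" "exp (- f p / 2) = 1 / exp (f p / 2)"
    "exp (- (f p / 2)) = 1 / exp (f p / 2)"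
  by (simp_all flip: exp_add add: exp_minus field_simps)

lemma lie_metric_conf:
  assumes "VF X" "VF Y" "VF Z"
  shows "conf.lie_metric Z X Y p = exp (f p) * (Z p f * g p (X p) (Y p) + lie_metric Z X Y p)"
proof -
  have "Z p (\<lambda>q. exp (f q) * g q (X q) (Y q)) =
      exp (f p) * Z p f * g p (X p) (Y p) + exp (f p) * Z p (\<lambda>q. g q (X q) (Y q))"
    using assms
    by (simp add: T_fun_mult[OF VF_T[OF assms(3)]] smooth_conf_factors g_smooth
        T_fun_conf_factors[OF VF_T[OF assms(3)]])
  then show ?thesis
    unfolding conf.lie_metric_def lie_metric_def by (simp add: conf_metric_def algebra_simps)
qed

text \<open>The Lie derivative of the conformal metric along the rescaled field is computed twice,
  once from \<open>conf_nab\<close> and once by passing back to \<open>g\<close> and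
  \<open>\<xi>\<close>. Comparing the results and cancelling positive factors leaves the
  formula.\<close>

lemma lie_metric_xi:
  assumes X: "VF X" and Y: "VF Y"
  shows "lie_metric \<xi> X Y p =
    2 * exp (f p / 2) * (g p (X p) (Y p) - g p (X p) (\<xi> p) * g p (Y p) (\<xi> p))
    - \<xi> p f * g p (X p) (Y p) + (X p f * g p (Y p) (\<xi> p) + Y p f * g p (X p) (\<xi> p)) / 2"
proof -
  let ?l = "exp (f p / 2)" and ?x = "g p (X p) (\<xi> p)" and ?y = "g p (Y p) (\<xi> p)"
  note t = VF_T[OF X, of p] VF_T[OF Y, of p] VF_T[OF xi, of p] VF_T[OF conf_xi, of p]
  have xi': "conf_xi f \<xi> p = exp (- f p / 2) *\<^sub>R \<xi> p" by (simp add: conf_xi_def)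
  have xi_f: "conf_xi f \<xi> p f = exp (- f p / 2) * \<xi> p f" by (simp add: conf_xi_def scaleR_fun_def)
  have n: "nab p v (conf_xi f \<xi>) = (- (exp (- f p / 2) * v f / 2)) *\<^sub>R \<xi> p + exp (- f p / 2) *\<^sub>R nab p v \<xi>"
    if "v \<in> T p" for v
    using nab_leibniz[OF that xi smooth_conf_factors(3)] T_fun_conf_factors(3)[OF that]
    by (simp add: conf_xi_def)
  have "conf.lie_metric (conf_xi f \<xi>) X Y p =
      2 * exp (f p) * (g p (X p) (Y p) - ?x * ?y)"
  proof -
    have *: "conf_metric f g p (X p) (conf_xi f \<xi> p) = ?l * ?x"
      "conf_metric f g p (Y p) (conf_xi f \<xi> p) = ?l * ?y"
      using t by (simp_all add: conf_metric_def xi' g_simps exp_half field_simps)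
    have "conf.lie_metric (conf_xi f \<xi>) X Y p =
        conf_metric f g p (X p - (?l * ?x) *\<^sub>R conf_xi f \<xi> p) (Y p) +
        conf_metric f g p (X p) (Y p - (?l * ?y) *\<^sub>R conf_xi f \<xi> p)"
      by (simp only: conf.lie_metric_nab[OF X Y conf_xi] conf_nab[OF X] conf_nab[OF Y] *)
    then show ?thesis using t
      by (simp add: conf_metric_def xi' g_simps T_intros g_sym[of "\<xi> p"] exp_half field_simps)
  qed
  \<comment> \<open>The terms in \<open>X p f\<close> and \<open>Y p f\<close> come from
    differentiating the factor \<open>exp (- f / 2)\<close> of the rescaled field.\<close>
  moreover have "conf.lie_metric (conf_xi f \<xi>) X Y p = exp (f p) * exp (- f p / 2) *
      (\<xi> p f * g p (X p) (Y p) + lie_metric \<xi> X Y p - (X p f * ?y + Y p f * ?x) / 2)"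
    using t X Y xi nab_T[OF t(1) xi] nab_T[OF t(2) xi]
    unfolding lie_metric_conf[OF X Y conf_xi] lie_metric_nab[OF X Y conf_xi] lie_metric_nab[OF X Y xi]
      n[OF t(1)] n[OF t(2)]
    by (simp add: xi_f g_simps T_intros g_sym[of "\<xi> p"] field_simps)
  ultimately have "exp (f p) * (2 * (g p (X p) (Y p) - ?x * ?y)) = exp (f p) * (exp (- f p / 2) *
      (\<xi> p f * g p (X p) (Y p) + lie_metric \<xi> X Y p - (X p f * ?y + Y p f * ?x) / 2))"
    by (simp only: mult_ac)
  then have "2 * (g p (X p) (Y p) - ?x * ?y) = exp (- f p / 2) *
      (\<xi> p f * g p (X p) (Y p) + lie_metric \<xi> X Y p - (X p f * ?y + Y p f * ?x) / 2)"
    by simp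
  then show ?thesis unfolding exp_half by (simp add: field_simps)
qed

text \<open>The covariant derivative in \<open>conf_nab\<close> is symmetric, so the rescaled 1-form
  \<open>exp (f / 2) \<eta>\<close> is closed; the product rule then expresses the exterior
  derivative of \<open>\<eta>\<close> through \<open>df\<close>.\<close>

lemma d_eta:
  assumes X: "VF X" and Y: "VF Y"
  shows "X p (\<lambda>q. g q (Y q) (\<xi> q)) - Y p (\<lambda>q. g q (X q) (\<xi> q)) - g p (lie_bracket X Y p) (\<xi> p) =
    (Y p f * g p (X p) (\<xi> p) - X p f * g p (Y p) (\<xi> p)) / 2"
proof -
  let ?l = "exp (f p / 2)" and ?x = "g p (X p) (\<xi> p)" and ?y = "g p (Y p) (\<xi> p)"
  note t = VF_T[OF X] VF_T[OF Y] VF_T[OF xi] VF_T[OF conf_xi] VF_T[OF lie_bracket_VF[OF X Y]]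
  have e: "conf_metric f g q v (conf_xi f \<xi> q) = exp (f q / 2) * g q v (\<xi> q)" if "v \<in> T q" for q v
    using t(3)[of q] that by (simp add: conf_metric_def conf_xi_def g_simps exp_half field_simps)
  have "X p (\<lambda>q. conf_metric f g q (Y q) (conf_xi f \<xi> q)) - Y p (\<lambda>q. conf_metric f g q (X q) (conf_xi f \<xi> q))
      - conf_metric f g p (lie_bracket X Y p) (conf_xi f \<xi> p)
    = 2 * conf_metric f g p (nab' p (X p) (conf_xi f \<xi>)) (Y p) - conf.lie_metric (conf_xi f \<xi>) X Y p"
    using conf.nab_from_lie_metric[OF X Y conf_xi, of p] by simp
  also have "\<dots> = conf_metric f g p (nab' p (X p) (conf_xi f \<xi>)) (Y p) -
      conf_metric f g p (X p) (nab' p (Y p) (conf_xi f \<xi>))"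
    by (simp add: conf.lie_metric_nab[OF X Y conf_xi])
  also have "\<dots> = 0"
    unfolding conf_nab[OF X] conf_nab[OF Y]
    using t[of p] by (simp add: conf.g_simps T_intros conf.g_sym[of "conf_xi f \<xi> p"])
  finally have "X p (\<lambda>q. exp (f q / 2) * g q (Y q) (\<xi> q)) - Y p (\<lambda>q. exp (f q / 2) * g q (X q) (\<xi> q))
      - ?l * g p (lie_bracket X Y p) (\<xi> p) = 0"
    by (simp add: e t)
  then have "?l * (X p f * ?y / 2 + X p (\<lambda>q. g q (Y q) (\<xi> q)) - Y p f * ?x / 2 -
      Y p (\<lambda>q. g q (X q) (\<xi> q)) - g p (lie_bracket X Y p) (\<xi> p)) = 0"
    using X Y xi
    by (simp add: T_fun_mult[OF t(1)] T_fun_mult[OF t(2)] smooth_conf_factors g_smooth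
        T_fun_conf_factors(2)[OF t(1)] T_fun_conf_factors(2)[OF t(2)] algebra_simps)
  then have "X p f * ?y / 2 + X p (\<lambda>q. g q (Y q) (\<xi> q)) - Y p f * ?x / 2 -
      Y p (\<lambda>q. g q (X q) (\<xi> q)) - g p (lie_bracket X Y p) (\<xi> p) = 0"
    by (simp only: mult_eq_0_iff exp_not_eq_zero simp_thms)
  then show ?thesis by (simp add: field_simps)
qed

text \<open>Sum of the symmetric part \<open>lie_metric_xi\<close> and the antisymmetric part
  \<open>d_eta\<close>, in which the terms with \<open>X p f\<close> cancel.\<close>

lemma nab_xi:
  assumes X: "VF X" and Y: "VF Y"
  shows "2 * g p (nab p (X p) \<xi>) (Y p) =
    2 * exp (f p / 2) * (g p (X p) (Y p) - g p (X p) (\<xi> p) * g p (Y p) (\<xi> p))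
    - \<xi> p f * g p (X p) (Y p) + Y p f * g p (X p) (\<xi> p)"
  using nab_from_lie_metric[OF X Y xi, of p] lie_metric_xi[OF X Y, of p] d_eta[OF X Y, of p]
  by (simp add: field_simps)

end

subsection \<open>Vectors tangent to a submanifold\<close>

context smooth_manifold
begin

text \<open>A vector tangent to \<open>S\<close> is the velocity of a curve in \<open>S\<close>,
  namely of a straight line in a slice chart. A function that vanishes on \<open>S\<close> near
  \<open>p\<close> vanishes along it and so has derivative zero.\<close>

lemma tangent_sub_zero:
  assumes "v \<in> tangent_sub \<A> k S p" "p \<in> S" "open V" "p \<in> V" "SF h" "\<And>q. q \<in> S \<inter> V \<Longrightarrow> h q = 0"
  shows "v h = 0"
proof -
  from assms(1) obtain c L e where c: "slice_chart \<A> k S c L" and p: "p \<in> fst c"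
    and e: "e \<in> L" and v: "v = dir_deriv \<A> c p e"
    by (auto simp: tangent_sub_def)
  have cm: "c \<in> max_atlas \<A>" "subspace L" "snd c ` (S \<inter> fst c) = snd c ` fst c \<inter> L"
    using c by (auto simp: slice_chart_def)
  note ch = max_atlasD(1)[OF cm(1)]
  define x where "x = snd c p"
  define U where "U = {y \<in> snd c ` fst c. chart_inv c y \<in> V}"
  \<comment> \<open>The line through the image of \<open>p\<close> in direction \<open>e\<close>
    stays in \<open>L\<close>, since \<open>x\<close> and \<open>e\<close> lie there; within
    \<open>U\<close> it therefore runs in the image of \<open>S\<close>.\<close>
  define G where "G = (\<lambda>t::real. x + t *\<^sub>R e)"
  have "open U" unfolding U_def by (rule open_chart_preimage[OF ch assms(3)])
  then have "open (G -` U)" unfolding G_def by (intro open_vimage continuous_intros)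
  moreover have x: "x \<in> U" "x \<in> L" using p assms(2,4) cm(3) ch by (auto simp: U_def x_def chart_inv_left)
  then have "0 \<in> G -` U" by (simp add: G_def)
  moreover have "(h \<circ> chart_inv c) (G t) = 0" if "t \<in> G -` U" for t
  proof -
    have "G t \<in> L" unfolding G_def by (intro subspace_add subspace_scale x e cm)
    then have "G t \<in> snd c ` (S \<inter> fst c)" using that cm(3) by (auto simp: U_def)
    then obtain q where "q \<in> S \<inter> fst c" "G t = snd c q" by auto
    then show ?thesis using that assms(6)[of q] ch by (simp add: U_def chart_inv_left)
  qed
  ultimately have 0: "((\<lambda>t. (h \<circ> chart_inv c) (G t)) has_derivative (\<lambda>t. 0)) (at 0)"
    by (intro has_derivative_transform_within_open[OF has_derivative_const[of 0], of "G -` U"]) auto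
  have "(h \<circ> chart_inv c has_derivative frechet_derivative (h \<circ> chart_inv c) (at x)) (at (G 0))"
    using differentiable_chart[OF assms(5) cm(1) p] by (simp add: G_def x_def frechet_derivative_works)
  moreover have "(G has_derivative (\<lambda>t. t *\<^sub>R e)) (at 0)"
    unfolding G_def by (auto intro!: derivative_eq_intros)
  ultimately have "((h \<circ> chart_inv c) \<circ> G has_derivative
      frechet_derivative (h \<circ> chart_inv c) (at x) \<circ> (\<lambda>t. t *\<^sub>R e)) (at 0)"
    by (intro diff_chain_at)
  from has_derivative_unique[OF this[unfolded o_def[of _ G]] 0]
  have "frechet_derivative (h \<circ> chart_inv c) (at x) (1 *\<^sub>R e) = 0" by (metis o_apply)
  then show ?thesis using assms(5) by (simp add: v dir_deriv_def x_def)
qed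

lemma tangent_sub_cong:
  assumes "v \<in> tangent_sub \<A> k S p" "v \<in> T p" "p \<in> S" "open V" "p \<in> V" "SF h" "SF h'"
    "\<And>q. q \<in> S \<inter> V \<Longrightarrow> h q = h' q"
  shows "v h = v h'"
  using tangent_sub_zero[OF assms(1,3,4,5) smooth_diff[OF assms(6,7)]] assms(8)
    T_fun_diff[OF assms(2,6,7)] by simp

lemma tangent_sub_subset: "tangent_sub \<A> k S p \<subseteq> T p"
proof
  fix v assume "v \<in> tangent_sub \<A> k S p"
  then obtain c e where "c \<in> max_atlas \<A>" "p \<in> fst c" "v = dir_deriv \<A> c p e"
    unfolding tangent_sub_def slice_chart_def by blast
  then show "v \<in> T p" using tangent_space_eq_range[of c p] by simp
qed

text \<open>In one slice chart the coordinate vector of \<open>N\<close> lies outside the subspace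
  \<open>L\<close> of codimension one, hence spans the model space together with
  \<open>L\<close>.\<close>

lemma tangent_sub_codim_1:
  assumes S: "embedded_submanifold \<A> k S" and dim: "DIM('e) = Suc k" and p: "p \<in> S"
    and N: "N \<in> T p" "N \<notin> tangent_sub \<A> k S p" and v: "v \<in> T p"
  obtains t a where "t \<in> tangent_sub \<A> k S p" "v = t + a *\<^sub>R N"
proof -
  obtain c L where c: "slice_chart \<A> k S c L" "p \<in> fst c"
    using S p unfolding embedded_submanifold_def by blast
  have L: "c \<in> max_atlas \<A>" "subspace L" "dim L = k" using c by (auto simp: slice_chart_def)
  note range = tangent_space_eq_range[OF L(1) c(2)]
  obtain x y where x: "N = dir_deriv \<A> c p x" and y: "v = dir_deriv \<A> c p y"
    using N v unfolding range by blast
  have "x \<notin> L" using N(2) c unfolding x tangent_sub_def by blast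
  moreover have sL: "span L = L" using L(2) by (simp only: span_eq_iff)
  ultimately have "dim (insert x L) = DIM('e)"
    using L(3) dim by (simp add: dim_insert sL)
  then have "span (insert x L) = UNIV" by (simp add: dim_eq_full)
  then obtain a where a: "y - a *\<^sub>R x \<in> L"
    using span_breakdown_eq[of y x L] sL by auto
  have "v = dir_deriv \<A> c p (y - a *\<^sub>R x) + a *\<^sub>R N"
    unfolding x y dir_deriv_scaleR[OF L(1) c(2), symmetric] dir_deriv_add[OF L(1) c(2), symmetric] by simp
  moreover have "dir_deriv \<A> c p (y - a *\<^sub>R x) \<in> tangent_sub \<A> k S p"
    using a c unfolding tangent_sub_def by blast
  ultimately show ?thesis using that by blast
qed

section \<open>Extension of tangent vectors to tangent fields\<close>

lemma extends_near_self: "VF X \<Longrightarrow> extends_near \<A> S p X X"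
  by (auto simp: extends_near_def)

lemma tangent_field_zero:
  assumes "\<And>q. q \<in> S \<Longrightarrow> subspace (tangent_sub \<A> k S q)"
  shows "tangent_field \<A> k S (\<lambda>q. 0)"
  using assms VF_zero unfolding tangent_field_def field_along_def
  by (auto intro: extends_near_self subspace_0)

lemma tangent_field_add:
  assumes "\<And>q. q \<in> S \<Longrightarrow> subspace (tangent_sub \<A> k S q)"
    and "tangent_field \<A> k S X" "tangent_field \<A> k S Y"
  shows "tangent_field \<A> k S (\<lambda>q. X q + Y q)"
  unfolding tangent_field_def field_along_def
proof (intro conjI ballI)
  fix p assume p: "p \<in> S"
  obtain X' Y' where "extends_near \<A> S p X X'" "extends_near \<A> S p Y Y'"
    using assms(2,3) p unfolding tangent_field_def field_along_def by blast
  then obtain V V' where "VF X'" "VF Y'" "open V" "open V'" "p \<in> V" "p \<in> V'"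
    "\<forall>q\<in>S \<inter> V. X' q = X q" "\<forall>q\<in>S \<inter> V'. Y' q = Y q"
    by (auto simp: extends_near_def)
  then have "extends_near \<A> S p (\<lambda>q. X q + Y q) (\<lambda>q. X' q + Y' q)"
    by (auto simp: extends_near_def VF_add intro!: exI[of _ "V \<inter> V'"])
  then show "\<exists>X'. extends_near \<A> S p (\<lambda>q. X q + Y q) X'" by blast
  show "X p + Y p \<in> tangent_sub \<A> k S p"
    using assms p by (auto simp: tangent_field_def intro: subspace_add)
qed

lemma tangent_field_scale:
  assumes "\<And>q. q \<in> S \<Longrightarrow> subspace (tangent_sub \<A> k S q)"
    and "tangent_field \<A> k S X"
  shows "tangent_field \<A> k S (\<lambda>q. a *\<^sub>R X q)"
  unfolding tangent_field_def field_along_def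
proof (intro conjI ballI)
  fix p assume p: "p \<in> S"
  obtain X' where "extends_near \<A> S p X X'"
    using assms p by (auto simp: tangent_field_def field_along_def)
  then have "extends_near \<A> S p (\<lambda>q. a *\<^sub>R X q) (\<lambda>q. a *\<^sub>R X' q)"
    by (auto simp: extends_near_def VF_scale)
  then show "\<exists>X'. extends_near \<A> S p (\<lambda>q. a *\<^sub>R X q) X'" by blast
  show "a *\<^sub>R X p \<in> tangent_sub \<A> k S p"
    using assms p by (auto simp: tangent_field_def intro: subspace_scale)
qed

text \<open>\<open>tangent_sub\<close> collects vectors from all slice charts at a point, so its
  being a subspace is an assumption here; \<open>cr_tangent_field\<close> obtains it from the CR
  decomposition.\<close>

lemma subspace_tangent_field_values:
  assumes "\<And>q. q \<in> S \<Longrightarrow> subspace (tangent_sub \<A> k S q)"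
  shows "subspace {X p | X. tangent_field \<A> k S X}"
proof (rule subspaceI)
  show "0 \<in> {X p | X. tangent_field \<A> k S X}"
    using tangent_field_zero[OF assms] by force
  show "x + y \<in> {X p | X. tangent_field \<A> k S X}"
    if "x \<in> {X p | X. tangent_field \<A> k S X}" "y \<in> {X p | X. tangent_field \<A> k S X}" for x y
    using tangent_field_add[OF assms] that by force
  show "a *\<^sub>R x \<in> {X p | X. tangent_field \<A> k S X}"
    if "x \<in> {X p | X. tangent_field \<A> k S X}" for a x
    using tangent_field_scale[OF assms] that by force
qed

text \<open>The frames in \<open>distribution\<close> consist of fields tangent along all of
  \<open>S\<close>, so a combination of frame vectors at \<open>p\<close> extends with constant
  coefficients and without cut-off functions.\<close>

lemma distribution_values:
  assumes "distribution \<A> k S D" "p \<in> S" "\<And>q. q \<in> S \<Longrightarrow> subspace (tangent_sub \<A> k S q)"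
  shows "D p \<subseteq> {X p | X. tangent_field \<A> k S X}"
proof -
  from assms(1,2) obtain r E where E: "\<forall>i<r. tangent_field \<A> k S (E i)"
    "D p = span ((\<lambda>i. E i p) ` {..<r::nat})"
    unfolding distribution_def by (metis IntI)
  show "D p \<subseteq> {X p | X. tangent_field \<A> k S X}"
    unfolding E(2) by (rule span_minimal[OF _ subspace_tangent_field_values[OF assms(3)]]) (use E in auto)
qed

text \<open>Lie parallelism speaks of fields tangent along \<open>S\<close>. To use it for a single
  vector, the vector is split by the CR decomposition and each part is extended by the frames of its
  distribution.\<close>

lemma cr_tangent_field:
  assumes cr: "cr_decomposition \<A> k \<phi> g S D D'" and p: "p \<in> S" and v: "v \<in> tangent_sub \<A> k S p"
  obtains X X' V where "tangent_field \<A> k S X" "VF X'" "X p = v" "open V" "p \<in> V"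
    "\<And>q. q \<in> S \<inter> V \<Longrightarrow> X' q = X q"
proof -
  have D: "distribution \<A> k S D" "distribution \<A> k S D'"
    and sum: "\<And>q. q \<in> S \<Longrightarrow> tangent_sub \<A> k S q = {u + v | u v. u \<in> D q \<and> v \<in> D' q}"
    using cr by (auto simp: cr_decomposition_def)
  have DD: "subspace (D q)" "subspace (D' q)" if "q \<in> S" for q
    using D that unfolding distribution_def by (metis IntI subspace_span)+
  have sub: "subspace (tangent_sub \<A> k S q)" if "q \<in> S" for q
    unfolding sum[OF that] using subspace_sums[OF DD[OF that]] by simp
  from v obtain u w where "u \<in> D p" "w \<in> D' p" "v = u + w" unfolding sum[OF p] by blast
  then have "v \<in> {X p | X. tangent_field \<A> k S X}"
    using distribution_values[OF D(1) p sub] distribution_values[OF D(2) p sub]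
      subspace_add[OF subspace_tangent_field_values[OF sub, of p]] by blast
  then obtain X where X: "tangent_field \<A> k S X" "X p = v" by blast
  then obtain X' where "extends_near \<A> S p X X'"
    using p by (auto simp: tangent_field_def field_along_def)
  then show ?thesis using that X by (auto simp: extends_near_def)
qed

end

section \<open>Independence of the chosen extensions\<close>

context riemannian_manifold
begin

text \<open>Pairing \<open>nab p v (Y - Z)\<close> with itself needs \<open>v\<close> to be the value of a vector field.\<close>

lemma nab_eq_on_sub:
  assumes X: "VF X" "X p \<in> tangent_sub \<A> k S p" and p: "p \<in> S"
    and YZ: "VF Y" "VF Z" "open V" "p \<in> V" "\<And>q. q \<in> S \<inter> V \<Longrightarrow> Y q = Z q"
  shows "nab p (X p) Y = nab p (X p) Z"
proof -
  let ?D = "\<lambda>q. Y q - Z q"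
  let ?E = "\<lambda>q. nab q (X q) ?D"
  have D: "VF ?D" and E: "VF ?E" using X YZ by (auto intro!: VF_diff nab_VF)
  have zero: "g q 0 w = 0" if "w \<in> T q" for q w
    using g_scale_left[OF that T_zero, of 0] by simp
  have "X p (\<lambda>q. g q (?D q) (?E q)) = 0"
    by (rule tangent_sub_zero[OF X(2) p YZ(3,4) g_smooth[OF D E]])
      (use YZ(5) VF_T[OF E] zero in auto)
  moreover have "?D p = 0" using YZ p by simp
  then have "g p (?D p) (nab p (X p) ?E) = 0" using zero nab_T[OF VF_T[OF X(1)] E] by simp
  ultimately have "g p (?E p) (?E p) = 0"
    using nab_metric[OF VF_T[OF X(1)] D E] by simp
  then have "?E p = 0" using g_eq_0 VF_T[OF E] by blast
  then show ?thesis using nab_diff[OF VF_T[OF X(1)] YZ(1,2)] by simp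
qed

lemma nabla_along_eq:
  assumes X: "VF X" "X p \<in> tangent_sub \<A> k S p" and p: "p \<in> S"
    and YZ: "extends_near \<A> S p Y Z"
  shows "nabla_along \<A> nab S p (X p) Y = nab p (X p) Z"
  unfolding nabla_along_def
proof (rule the_equality)
  show "\<exists>Y'. extends_near \<A> S p Y Y' \<and> nab p (X p) Z = nab p (X p) Y'" using YZ by blast
  fix w assume "\<exists>Y'. extends_near \<A> S p Y Y' \<and> w = nab p (X p) Y'"
  then obtain Y' V V' where "w = nab p (X p) Y'" "VF Y'" "VF Z"
    and V: "open V" "p \<in> V" "\<forall>q\<in>S \<inter> V. Y' q = Y q" "open V'" "p \<in> V'" "\<forall>q\<in>S \<inter> V'. Z q = Y q"
    using YZ by (auto simp: extends_near_def)
  with V show "w = nab p (X p) Z"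
    using nab_eq_on_sub[OF X p, of Y' Z "V \<inter> V'"] by (simp add: open_Int)
qed

text \<open>Each half of the bracket at \<open>p\<close> differentiates, along a vector tangent to
  \<open>S\<close>, a function whose values on \<open>S\<close> near \<open>p\<close> do not depend
  on the extension. This is where tangency of both fields at \<open>p\<close> enters.\<close>

lemma bracket_on_eq:
  assumes p: "p \<in> S" and X: "extends_near \<A> S p X X'" "X p \<in> tangent_sub \<A> k S p"
    and Y: "extends_near \<A> S p Y Y'" "Y p \<in> tangent_sub \<A> k S p"
  shows "bracket_on \<A> S X Y p = lie_bracket X' Y' p"
  unfolding bracket_on_def
proof (rule the_equality)
  show "\<exists>X'' Y''. extends_near \<A> S p X X'' \<and> extends_near \<A> S p Y Y'' \<and>
      lie_bracket X' Y' p = lie_bracket X'' Y'' p"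
    using X Y by blast
  fix w assume "\<exists>X'' Y''. extends_near \<A> S p X X'' \<and> extends_near \<A> S p Y Y'' \<and> w = lie_bracket X'' Y'' p"
  then obtain X'' Y'' where e: "extends_near \<A> S p X X''" "extends_near \<A> S p Y Y''"
    and w: "w = lie_bracket X'' Y'' p" by blast
  have agree: "\<exists>V. open V \<and> p \<in> V \<and> (\<forall>q\<in>S \<inter> V. Z' q = Z'' q)" "VF Z'" "VF Z''" "Z' p = Z p" "Z'' p = Z p"
    if "extends_near \<A> S p Z Z'" "extends_near \<A> S p Z Z''" for Z Z' Z'' :: "'m vfield"
  proof -
    from that obtain V V' where "open V" "p \<in> V" "\<forall>q\<in>S \<inter> V. Z' q = Z q"
      "open V'" "p \<in> V'" "\<forall>q\<in>S \<inter> V'. Z'' q = Z q"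
      by (auto simp: extends_near_def)
    then show "\<exists>V. open V \<and> p \<in> V \<and> (\<forall>q\<in>S \<inter> V. Z' q = Z'' q)"
      by (intro exI[of _ "V \<inter> V'"]) auto
  qed (use that p in \<open>auto simp: extends_near_def\<close>)
  note AX = agree[OF X(1) e(1)] and AY = agree[OF Y(1) e(2)]
  have "X p (\<lambda>q. Y' q h) = X p (\<lambda>q. Y'' q h)" "Y p (\<lambda>q. X' q h) = Y p (\<lambda>q. X'' q h)" if "SF h" for h
  proof -
    from AY(1) obtain V where "open V" "p \<in> V" "\<forall>q\<in>S \<inter> V. Y' q = Y'' q" by blast
    then show "X p (\<lambda>q. Y' q h) = X p (\<lambda>q. Y'' q h)"
      using tangent_sub_cong[OF X(2) _ p, of V "\<lambda>q. Y' q h" "\<lambda>q. Y'' q h"] VF_T[OF AX(2), of p] AX(4)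
        VF_smooth[OF AY(2) that] VF_smooth[OF AY(3) that] by auto
    from AX(1) obtain V where "open V" "p \<in> V" "\<forall>q\<in>S \<inter> V. X' q = X'' q" by blast
    then show "Y p (\<lambda>q. X' q h) = Y p (\<lambda>q. X'' q h)"
      using tangent_sub_cong[OF Y(2) _ p, of V "\<lambda>q. X' q h" "\<lambda>q. X'' q h"] VF_T[OF AY(2), of p] AY(4)
        VF_smooth[OF AX(2) that] VF_smooth[OF AX(3) that] by auto
  qed
  moreover have "X' q h = X'' q h" "Y' q h = Y'' q h" if "\<not> SF h" for q h
    using that AX AY by (simp_all add: T_nonsmooth[OF VF_T])
  ultimately show "w = lie_bracket X' Y' p"
    unfolding w lie_bracket_def AX(4,5) AY(4,5)
    by (intro ext, rename_tac h, case_tac "smooth_fun \<A> h") simp_all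
qed

end

subsection \<open>Hypersurfaces whose unit normal is a gradient\<close>

locale gradient_normal_hypersurface = conformal_kenmotsu_manifold \<A> g nab \<xi> W f nab'
  for \<A> :: "('m::{t2_space,second_countable_topology}, 'e::euclidean_space) chart set"
    and g :: "'m metric" and nab :: "'m connection" and \<xi> W :: "'m vfield"
    and f :: "'m \<Rightarrow> real" and nab' :: "'m connection" +
  fixes k :: nat and S :: "'m set"
  assumes embedded: "embedded_submanifold \<A> k S" and dim: "DIM('e) = Suc k"
    and normal: "q \<in> S \<Longrightarrow> w \<in> tangent_sub \<A> k S q \<Longrightarrow> g q (W q) w = 0"
    and unit: "q \<in> S \<Longrightarrow> g q (W q) (W q) = 1"
    and xi_tangent: "q \<in> S \<Longrightarrow> \<xi> q \<in> tangent_sub \<A> k S q"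
begin

text \<open>The fields are ambient so that they can also be differentiated along the normal;
  tangency is asked only at points of \<open>S\<close> close to \<open>p\<close>, which is what an
  extension of a tangent field guarantees.\<close>

definition tangent_near :: "'m \<Rightarrow> 'm vfield \<Rightarrow> bool"
  where "tangent_near p X \<longleftrightarrow> VF X \<and>
    (\<exists>V. open V \<and> p \<in> V \<and> (\<forall>q\<in>S \<inter> V. X q \<in> tangent_sub \<A> k S q))"

lemma tangent_f: "q \<in> S \<Longrightarrow> v \<in> tangent_sub \<A> k S q \<Longrightarrow> v f = 0"
  using grad[of v q] normal[of q v] tangent_sub_subset by auto

lemma W_f: "q \<in> S \<Longrightarrow> W q f = 1"
  using grad[of "W q" q] unit VF_T[OF W] by simp

lemma tangent_near_xi: "tangent_near p \<xi>"
  using xi xi_tangent by (auto simp: tangent_near_def)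

text \<open>On \<open>S\<close> the functions \<open>\<xi> q f\<close> and \<open>W q f\<close> are
  the constants \<open>0\<close> and \<open>1\<close>, so tangent vectors annihilate them.\<close>

lemma tangent_nearD:
  assumes "p \<in> S" "tangent_near p X"
  shows "VF X" "X p \<in> tangent_sub \<A> k S p" "X p f = 0" "X p (\<lambda>q. \<xi> q f) = 0"
    "X p (\<lambda>q. W q f) = 0"
proof -
  show X: "VF X" "X p \<in> tangent_sub \<A> k S p" using assms by (auto simp: tangent_near_def)
  show "X p f = 0" using tangent_f assms X by blast
  show "X p (\<lambda>q. \<xi> q f) = 0"
    by (rule tangent_sub_zero[OF X(2) assms(1) open_UNIV UNIV_I VF_smooth[OF xi f]])
      (use tangent_f xi_tangent in auto)
  have "X p (\<lambda>q. W q f) = X p (\<lambda>q. 1)"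
    by (rule tangent_sub_cong[OF X(2) VF_T[OF X(1)] assms(1) open_UNIV UNIV_I VF_smooth[OF W f] smooth_const])
      (use W_f in auto)
  then show "X p (\<lambda>q. W q f) = 0" using T_fun_const[OF VF_T[OF X(1)]] by simp
qed

lemma tangent_near_fun_zero:
  assumes "p \<in> S" "tangent_near p X" "tangent_near p Y" "SF h"
    and "\<And>q. q \<in> S \<Longrightarrow> Y q \<in> tangent_sub \<A> k S q \<Longrightarrow> h q = 0"
  shows "X p h = 0"
proof -
  obtain V where "open V" "p \<in> V" "\<forall>q\<in>S \<inter> V. Y q \<in> tangent_sub \<A> k S q"
    using assms(3) by (auto simp: tangent_near_def)
  then show ?thesis
    using tangent_sub_zero[OF tangent_nearD(2)[OF assms(1,2)] assms(1) _ _ assms(4), of V] assms(5) by blast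
qed

lemma orthogonal_tangent:
  assumes "p \<in> S" "v \<in> T p" "g p (W p) v = 0"
  shows "v \<in> tangent_sub \<A> k S p"
proof -
  have "W p \<notin> tangent_sub \<A> k S p" using normal unit assms(1) by fastforce
  then obtain t a where t: "t \<in> tangent_sub \<A> k S p" and v: "v = t + a *\<^sub>R W p"
    using tangent_sub_codim_1[OF embedded dim assms(1) VF_T[OF W] _ assms(2)] by blast
  have "g p (W p) v = a"
    using t tangent_sub_subset VF_T[OF W, of p] normal[OF assms(1) t] unit[OF assms(1)]
    unfolding v by (subst g_add_right) (auto simp: T_intros g_simps)
  then show ?thesis using t v assms(3) by simp
qed

lemma decompose:
  assumes "p \<in> S" "v \<in> T p"
  obtains t where "t \<in> tangent_sub \<A> k S p" "v = t + g p (W p) v *\<^sub>R W p"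
proof -
  note t = VF_T[OF W, of p] assms(2)
  have "v - g p (W p) v *\<^sub>R W p \<in> tangent_sub \<A> k S p"
    by (rule orthogonal_tangent) (use t assms unit in \<open>auto simp: T_intros g_simps\<close>)
  then show ?thesis using that by force
qed

text \<open>Pairing with the gradient \<open>W\<close> is differentiation of \<open>f\<close>, and
  the bracket annihilates \<open>f\<close> at \<open>p\<close> because \<open>X f\<close> and
  \<open>\<xi> f\<close> both vanish on \<open>S\<close> near \<open>p\<close>.\<close>

lemma lie_bracket_xi_tangent:
  assumes "p \<in> S" "tangent_near p X"
  shows "lie_bracket \<xi> X p \<in> tangent_sub \<A> k S p"
proof (rule orthogonal_tangent[OF assms(1)])
  note X = tangent_nearD[OF assms]
  show *: "lie_bracket \<xi> X p \<in> T p" using VF_T lie_bracket_VF xi X by blast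
  have "\<xi> p (\<lambda>q. X q f) = 0"
    by (rule tangent_near_fun_zero[OF assms(1) tangent_near_xi assms(2) VF_smooth[OF X(1) f]])
      (use tangent_f in auto)
  then have "lie_bracket \<xi> X p f = 0" using X by (simp add: lie_bracket_def)
  then show "g p (W p) (lie_bracket \<xi> X p) = 0" using grad[OF *] by simp
qed

text \<open>Differentiate the constants \<open>g (W, W) = 1\<close> and
  \<open>g (W, \<xi>) = 0\<close> along \<open>S\<close>. The first makes
  \<open>\<nabla>\<^sub>X W\<close> orthogonal to \<open>W\<close>, written as annihilating
  \<open>f\<close>; the second, with \<open>nab_xi\<close>, gives its component along
  \<open>\<xi>\<close>.\<close>

lemma shape_facts:
  assumes p: "p \<in> S" and "tangent_near p X"
  shows "nab p (X p) W f = 0" "g p (nab p (X p) W) (\<xi> p) = - (g p (X p) (\<xi> p) / 2)"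
proof -
  note X = tangent_nearD[OF assms]
  have t: "nab p (X p) W \<in> T p" "nab p (X p) \<xi> \<in> T p" "X p \<in> T p" "W p \<in> T p" "\<xi> p \<in> T p"
    using X W xi by (auto intro: nab_T VF_T)
  have e: "(\<lambda>q. W q f) = (\<lambda>q. g q (W q) (W q))" "(\<lambda>q. \<xi> q f) = (\<lambda>q. g q (W q) (\<xi> q))"
    using grad VF_T[OF W] VF_T[OF xi] by auto
  have "X p (\<lambda>q. W q f) = 2 * g p (W p) (nab p (X p) W)"
    unfolding e using nab_metric[OF t(3) W W] g_sym[OF t(1,4)] by simp
  then show "nab p (X p) W f = 0" using X grad[OF t(1)] by simp
  have "X p (\<lambda>q. \<xi> q f) = g p (nab p (X p) W) (\<xi> p) + g p (nab p (X p) \<xi>) (W p)"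
    unfolding e using nab_metric[OF t(3) W xi] g_sym[OF t(2,4)] by simp
  moreover have "2 * g p (nab p (X p) \<xi>) (W p) = g p (X p) (\<xi> p)"
    using nab_xi[OF X(1) W, of p] normal[OF p X(2)] normal[OF p xi_tangent[OF p]] g_sym[OF t(3,4)]
      tangent_f[OF p xi_tangent[OF p]] W_f[OF p] by simp
  ultimately show "g p (nab p (X p) W) (\<xi> p) = - (g p (X p) (\<xi> p) / 2)" using X by simp
qed

text \<open>The Lie derivative of \<open>df\<close> along \<open>\<xi>\<close> is
  \<open>d (\<xi> f)\<close>. As \<open>df\<close> is pairing with \<open>W\<close>, the product
  rule splits it into the bracket and the derivative of \<open>g\<close>.\<close>

lemma bracket_gradient:
  assumes "VF Q"
  shows "g q (lie_bracket \<xi> W q) (Q q) = Q q (\<lambda>q. \<xi> q f) - lie_metric \<xi> W Q q"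
proof -
  have "(\<lambda>q. g q (W q) (Q q)) = (\<lambda>q. Q q f)" using grad VF_T[OF assms] by auto
  moreover have "g q (W q) (lie_bracket \<xi> Q q) = \<xi> q (\<lambda>q. Q q f) - Q q (\<lambda>q. \<xi> q f)"
    using grad[OF VF_T[OF lie_bracket_VF[OF xi assms]]] by (simp add: lie_bracket_def)
  ultimately show ?thesis by (simp add: lie_metric_def)
qed

text \<open>The value of \<open>lie_bracket \<xi> W\<close> on \<open>f\<close> is computed twice:
  as a commutator, where \<open>W f = 1\<close> on \<open>S\<close>, and by torsion-freeness, where
  \<open>nab_xi\<close> applies.\<close>

lemma W_xi_f:
  assumes p: "p \<in> S"
  shows "W p (\<lambda>q. \<xi> q f) = exp (f p / 2)"
proof -
  note t = VF_T[OF W, of p] VF_T[OF xi, of p]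
  have "lie_bracket \<xi> W p f = - W p (\<lambda>q. \<xi> q f)"
    using tangent_nearD(5)[OF p tangent_near_xi] by (simp add: lie_bracket_def)
  moreover have "lie_bracket \<xi> W p f = nab p (\<xi> p) W f - g p (nab p (W p) \<xi>) (W p)"
    using g_sym[OF nab_T[OF t(1) xi] t(1)] grad[OF nab_T[OF t(1) xi]]
    by (simp add: torsion_free xi W)
  moreover have "2 * g p (nab p (W p) \<xi>) (W p) = 2 * exp (f p / 2)"
    using nab_xi[OF W W, of p] unit[OF p] normal[OF p xi_tangent[OF p]]
      tangent_f[OF p xi_tangent[OF p]] by simp
  ultimately show ?thesis using shape_facts(1)[OF p tangent_near_xi] by simp
qed

text \<open>Metric compatibility reduces the left side to the derivative along \<open>X\<close> of
  the pairing of \<open>lie_bracket \<xi> W\<close> with \<open>Y\<close>, minus its pairing with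
  \<open>\<nabla>\<^sub>X Y\<close>; \<open>bracket_gradient\<close> evaluates both.\<close>

lemma nab_bracket:
  assumes p: "p \<in> S" and tX: "tangent_near p X" and tY: "tangent_near p Y"
  shows "g p (nab p (X p) (lie_bracket \<xi> W)) (Y p) =
    - exp (f p / 2) * g p (nab p (X p) W) (Y p)
    - exp (f p / 2) * (g p (X p) (Y p) - g p (X p) (\<xi> p) * g p (Y p) (\<xi> p)) / 2"
proof -
  note X = tangent_nearD[OF p tX] and Y = tangent_nearD[OF p tY]
  note xif = tangent_f[OF _ xi_tangent]
  let ?Z = "lie_bracket \<xi> W" and ?l = "exp (f p / 2)" and ?H = "g p (nab p (X p) W) (Y p)"
  define Q where "Q = (\<lambda>q. nab q (X q) Y)"
  have Z: "VF ?Z" and Q: "VF Q" using lie_bracket_VF xi W nab_VF X Y by (auto simp: Q_def)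
  note t = VF_T[OF X(1), of p] VF_T[OF Y(1), of p] VF_T[OF W, of p] VF_T[OF xi, of p] VF_T[OF Q, of p]
  have s: "SF (\<lambda>q. g q (Y q) (\<xi> q))" "SF (\<lambda>q. g q (?Z q) (Y q))"
    by (rule g_smooth Y xi Z)+
  \<comment> \<open>Paired with vectors tangent to \<open>S\<close>, the field \<open>?Z\<close>
    acts like \<open>- \<xi> / 2\<close>, so this sum vanishes on \<open>S\<close> near
    \<open>p\<close>.\<close>
  have "X p (\<lambda>q. g q (?Z q) (Y q) + 1/2 * g q (Y q) (\<xi> q)) = 0"
  proof (rule tangent_near_fun_zero[OF p tX tY])
    show "SF (\<lambda>q. g q (?Z q) (Y q) + 1/2 * g q (Y q) (\<xi> q))"
      by (intro smooth_add smooth_mult smooth_const s)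
    fix q assume q: "q \<in> S" "Y q \<in> tangent_sub \<A> k S q"
    have "Y q (\<lambda>q. \<xi> q f) = 0"
      by (rule tangent_sub_zero[OF q(2,1) open_UNIV UNIV_I VF_smooth[OF xi f]]) (use xif in auto)
    then show "g q (?Z q) (Y q) + 1/2 * g q (Y q) (\<xi> q) = 0"
      using bracket_gradient[OF Y(1), of q] lie_metric_xi[OF W Y(1), of q] normal[OF q]
        normal[OF q(1) xi_tangent[OF q(1)]] xif[OF q(1) q(1)] tangent_f[OF q] W_f[OF q(1)] by simp
  qed
  then have "X p (\<lambda>q. g q (?Z q) (Y q)) + 1/2 * X p (\<lambda>q. g q (Y q) (\<xi> q)) = 0"
    by (simp only: T_fun_add[OF t(1) s(2) smooth_mult[OF smooth_const s(1)]] T_fun_cmult[OF t(1) s(1)])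
  then have "X p (\<lambda>q. g q (?Z q) (Y q)) = - (g p (Q p) (\<xi> p) + g p (Y p) (nab p (X p) \<xi>)) / 2"
    using nab_metric[OF t(1) Y(1) xi] by (simp add: Q_def field_simps)
  moreover have "2 * g p (Y p) (nab p (X p) \<xi>) =
      2 * ?l * (g p (X p) (Y p) - g p (X p) (\<xi> p) * g p (Y p) (\<xi> p))"
    using nab_xi[OF X(1) Y(1), of p] Y xif[OF p p] g_sym[OF nab_T[OF t(1) xi] t(2)] by simp
  \<comment> \<open>The derivative \<open>Q p\<close> need not be tangent: its normal component is
    \<open>- ?H\<close>, and on that component the derivative of \<open>\<xi> f\<close> is given by
    \<open>W_xi_f\<close>.\<close>
  moreover have "g p (?Z p) (Q p) = ?l * ?H - g p (Q p) (\<xi> p) / 2"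
  proof -
    have "(\<lambda>q. g q (W q) (Y q)) = (\<lambda>q. Y q f)" using grad VF_T[OF Y(1)] by auto
    moreover have "X p (\<lambda>q. Y q f) = 0"
      by (rule tangent_near_fun_zero[OF p tX tY VF_smooth[OF Y(1) f]]) (use tangent_f in auto)
    ultimately have WQ: "g p (W p) (Q p) = - ?H"
      using nab_metric[OF t(1) W Y(1)] by (simp add: Q_def)
    obtain \<tau> where \<tau>: "\<tau> \<in> tangent_sub \<A> k S p" "Q p = \<tau> + g p (W p) (Q p) *\<^sub>R W p"
      using decompose[OF p t(5)] by blast
    have "\<tau> (\<lambda>q. \<xi> q f) = 0"
      by (rule tangent_sub_zero[OF \<tau>(1) p open_UNIV UNIV_I VF_smooth[OF xi f]]) (use xif in auto)
    then have "Q p (\<lambda>q. \<xi> q f) = - ?H * ?l"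
      using fun_cong[OF \<tau>(2), of "\<lambda>q. \<xi> q f"] WQ W_xi_f[OF p] by (simp add: scaleR_fun_def)
    then show ?thesis
      using bracket_gradient[OF Q, of p] lie_metric_xi[OF W Q, of p] WQ
        normal[OF p xi_tangent[OF p]] xif[OF p p] W_f[OF p] grad[OF t(5)] by simp
  qed
  ultimately show ?thesis
    using nab_metric[OF t(1) Z Y(1)] by (simp add: Q_def[symmetric] Q_def[THEN fun_cong, symmetric] field_simps)
qed

lemma umbilic_at:
  assumes p: "p \<in> S" and tX: "tangent_near p X" and tY: "tangent_near p Y"
    and lie: "lie_bracket \<xi> (\<lambda>q. nab q (X q) W) p = nab p (lie_bracket \<xi> X p) W"
  shows "g p (nab p (X p) W) (Y p) = - (g p (X p) (Y p) / 2)"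
proof -
  note X = tangent_nearD[OF p tX] and Y = tangent_nearD[OF p tY]
  note xif = tangent_f[OF p xi_tangent[OF p]]
  define B where "B = (\<lambda>q. nab q (X q) W)"
  have B: "VF B" using nab_VF X W by (auto simp: B_def)
  note t = VF_T[OF X(1), of p] VF_T[OF Y(1), of p] VF_T[OF W, of p] VF_T[OF xi, of p] VF_T[OF B, of p]
  let ?Z = "lie_bracket \<xi> W" and ?l = "exp (f p / 2)" and ?H = "g p (B p) (Y p)"
    and ?x = "g p (X p) (\<xi> p)" and ?y = "g p (Y p) (\<xi> p)" and ?g = "g p (X p) (Y p)"
  note br = lie_bracket_VF[OF xi X(1)] lie_bracket_VF[OF xi Y(1)] lie_bracket_VF[OF W X(1)] lie_bracket_VF[OF W Y(1)]
  note hess = lie_metric_gradient[OF _ _ W f grad]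
  have "\<xi> p (lie_metric W X Y) = 2 * \<xi> p (\<lambda>q. g q (B q) (Y q))"
  proof -
    have "lie_metric W X Y = (\<lambda>q. 2 * g q (B q) (Y q))"
      using hess[OF X(1) Y(1)] by (auto simp: B_def)
    then show ?thesis using T_fun_cmult[OF t(4) g_smooth[OF B Y(1)]] by simp
  qed
  \<comment> \<open>Lie parallelism replaces the derivative of \<open>W\<close> along
    \<open>lie_bracket \<xi> X\<close> by the bracket with \<open>B\<close>, so that the whole left
    side becomes twice \<open>lie_metric \<xi> B Y p\<close>.\<close>
  moreover have "lie_metric W (lie_bracket \<xi> X) Y p = 2 * g p (lie_bracket \<xi> B p) (Y p)"
    using hess[OF br(1) Y(1)] lie by (simp add: B_def)
  moreover have "lie_metric W X (lie_bracket \<xi> Y) p = 2 * g p (B p) (lie_bracket \<xi> Y p)"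
    using hess[OF X(1) br(2)] by (simp add: B_def)
  moreover have "lie_metric \<xi> B Y p = 2 * ?l * ?H + ?l * ?x * ?y"
    using lie_metric_xi[OF B Y(1), of p] shape_facts[OF p tX] Y xif by (simp add: B_def field_simps)
  ultimately have lhs: "\<xi> p (lie_metric W X Y) - lie_metric W (lie_bracket \<xi> X) Y p -
      lie_metric W X (lie_bracket \<xi> Y) p = 4 * ?l * ?H + 2 * ?l * ?x * ?y"
    by (simp add: lie_metric_def)
  \<comment> \<open>\<open>W\<close> is transverse to \<open>S\<close>, so the formula for
    \<open>lie_metric \<xi>\<close> is differentiated as an identity on the whole manifold. At
    \<open>p\<close> the coefficients \<open>\<xi> f\<close>, \<open>X f\<close> and
    \<open>Y f\<close> vanish, but their derivatives along \<open>W\<close> remain.\<close>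
  have "W p (lie_metric \<xi> X Y) =
     ?l * (?g - ?x * ?y) + 2 * ?l * (W p (\<lambda>q. g q (X q) (Y q))
       - W p (\<lambda>q. g q (X q) (\<xi> q)) * ?y - ?x * W p (\<lambda>q. g q (Y q) (\<xi> q)))
     - ?l * ?g + (W p (\<lambda>q. X q f) * ?y + W p (\<lambda>q. Y q f) * ?x) / 2"
  proof -
    have e: "lie_metric \<xi> X Y = (\<lambda>q. 2 * (exp (f q / 2) * (g q (X q) (Y q) - g q (X q) (\<xi> q) * g q (Y q) (\<xi> q)))
      - \<xi> q f * g q (X q) (Y q) + 1/2 * (X q f * g q (Y q) (\<xi> q) + Y q f * g q (X q) (\<xi> q)))"
      using lie_metric_xi[OF X(1) Y(1)] by (auto simp: mult_ac)
    have s: "SF (\<lambda>q. g q (X q) (Y q))" "SF (\<lambda>q. g q (X q) (\<xi> q))" "SF (\<lambda>q. g q (Y q) (\<xi> q))"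
      "SF (\<lambda>q. X q f)" "SF (\<lambda>q. Y q f)" "SF (\<lambda>q. \<xi> q f)"
      by (rule g_smooth VF_smooth X Y xi f)+
    show ?thesis unfolding e
      by (simp only: T_fun_add[OF t(3)] T_fun_diff[OF t(3)] T_fun_cmult[OF t(3)] T_fun_mult[OF t(3)] s
          smooth_add smooth_diff smooth_mult smooth_const smooth_conf_factors T_fun_conf_factors(2)[OF t(3)])
        (simp add: X(3) Y(3) xif W_xi_f[OF p] W_f[OF p] field_simps)
  qed
  \<comment> \<open>As \<open>W f = 1\<close> on \<open>S\<close>, the bracket of \<open>W\<close>
    with \<open>X\<close> sends \<open>f\<close> to the derivative of \<open>X f\<close> along
    \<open>W\<close>; the last term cancels its counterpart in the preceding formula.\<close>
  moreover have "lie_metric \<xi> (lie_bracket W X) Y p =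
      2 * ?l * (g p (lie_bracket W X p) (Y p) - g p (lie_bracket W X p) (\<xi> p) * ?y) + W p (\<lambda>q. X q f) * ?y / 2"
    using lie_metric_xi[OF br(3) Y(1), of p] X(5) Y(3) xif by (simp add: lie_bracket_def[of W X p])
  moreover have "lie_metric \<xi> X (lie_bracket W Y) p =
      2 * ?l * (g p (X p) (lie_bracket W Y p) - g p (lie_bracket W Y p) (\<xi> p) * ?x) + W p (\<lambda>q. Y q f) * ?x / 2"
    using lie_metric_xi[OF X(1) br(4), of p] Y(5) X(3) xif by (simp add: lie_bracket_def[of W Y p])
  moreover have "W p (\<lambda>q. g q (X q) (\<xi> q)) - g p (lie_bracket W X p) (\<xi> p) = - (?x / 2)"
    "W p (\<lambda>q. g q (Y q) (\<xi> q)) - g p (lie_bracket W Y p) (\<xi> p) = - (?y / 2)"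
  proof -
    have "(\<lambda>q. g q (W q) (\<xi> q)) = (\<lambda>q. \<xi> q f)" using grad VF_T[OF xi] by auto
    then show "W p (\<lambda>q. g q (X q) (\<xi> q)) - g p (lie_bracket W X p) (\<xi> p) = - (?x / 2)"
      "W p (\<lambda>q. g q (Y q) (\<xi> q)) - g p (lie_bracket W Y p) (\<xi> p) = - (?y / 2)"
      using d_eta[OF W X(1), of p] d_eta[OF W Y(1), of p] X Y W_f[OF p] by simp_all
  qed
  moreover have "W p (\<lambda>q. g q (X q) (Y q)) - g p (lie_bracket W X p) (Y p) - g p (X p) (lie_bracket W Y p) = 2 * ?H"
    using hess[OF X(1) Y(1), of p] by (simp add: lie_metric_def B_def)
  moreover have "lie_metric ?Z X Y p = - 2 * ?l * ?H - ?l * (?g - ?x * ?y)"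
    using nab_bracket[OF p tX tY] nab_bracket[OF p tY tX] hessian_sym[OF X(1) Y(1) W f grad, of p]
      g_sym[OF t(1,2)] g_sym[OF t(1) nab_T[OF t(2) lie_bracket_VF[OF xi W]]] g_sym[OF t(1) nab_T[OF t(2) W]]
    by (simp add: lie_metric_nab[OF X(1) Y(1) lie_bracket_VF[OF xi W]] B_def field_simps)
  ultimately have "4 * ?l * ?H + 2 * ?l * ?x * ?y = 4 * ?l * ?H + ?l * ?x * ?y - 2 * ?l * ?H - ?l * (?g - ?x * ?y)"
    using lie_metric_commutator[OF xi W X(1) Y(1), of p] lhs by algebra
  \<comment> \<open>The terms in \<open>?x * ?y\<close> cancel.\<close>
  then have "?l * (2 * ?H + ?g) = 0" by algebra
  then have "2 * ?H + ?g = 0" by simp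
  then show ?thesis by (simp add: B_def)
qed

section \<open>From Lie parallelism to total umbilicity\<close>

lemma shape_operator_eq:
  assumes q: "q \<in> S" and N: "\<forall>q\<in>S. W q = N q" and X: "VF X" "X q \<in> tangent_sub \<A> k S q"
  shows "shape_operator \<A> nab S N q (X q) = - nab q (X q) W"
proof -
  have "extends_near \<A> S q N W"
    using W N by (auto simp: extends_near_def)
  then show ?thesis using nabla_along_eq[OF X q] by (simp add: shape_operator_def)
qed

text \<open>Translates \<open>bracket_on\<close> and \<open>shape_operator\<close>, which concern
  fields along \<open>S\<close>, into ambient fields; the signs from \<open>A = - \<nabla> W\<close>
  on both sides cancel.\<close>

lemma lie_parallel_at:
  assumes p: "p \<in> S" and N: "\<forall>q\<in>S. W q = N q"
    and lp: "lie_parallel \<A> k S \<xi> (shape_operator \<A> nab S N)"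
    and X: "tangent_field \<A> k S X" and X': "extends_near \<A> S p X X'"
  shows "lie_bracket \<xi> (\<lambda>q. nab q (X' q) W) p = nab p (lie_bracket \<xi> X' p) W"
proof -
  let ?A = "shape_operator \<A> nab S N" and ?B = "\<lambda>q. nab q (X' q) W"
  obtain V where V: "VF X'" "open V" "p \<in> V" "\<And>q. q \<in> S \<inter> V \<Longrightarrow> X' q = X q"
    using X' by (auto simp: extends_near_def)
  have Xt: "X q \<in> tangent_sub \<A> k S q" if "q \<in> S" for q
    using X that by (simp add: tangent_field_def)
  have t: "tangent_near p X'" using V Xt by (auto simp: tangent_near_def)
  have B: "VF ?B" using nab_VF[OF V(1) W] .
  have A: "?A q (X q) = - ?B q" if "q \<in> S \<inter> V" for q
    using shape_operator_eq[OF _ N V(1), of q] V(4)[OF that] Xt[of q] that by simp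
  then have ext: "extends_near \<A> S p (\<lambda>q. ?A q (X q)) (\<lambda>q. - ?B q)"
    using V VF_minus[OF B] by (auto simp: extends_near_def)
  \<comment> \<open>Tangency of the image vector is what \<open>bracket_on_eq\<close> requires for
    the bracket with \<open>\<xi>\<close>.\<close>
  have "?A p (X p) \<in> tangent_sub \<A> k S p"
  proof (rule orthogonal_tangent[OF p])
    have Ap: "?A p (X p) = - ?B p" using A p V by simp
    show "?A p (X p) \<in> T p" unfolding Ap by (intro T_minus VF_T[OF B])
    show "g p (W p) (?A p (X p)) = 0"
      unfolding Ap using grad[OF VF_T[OF B]] shape_facts(1)[OF p t] VF_T[OF B, of p] VF_T[OF W, of p]
      by (simp add: g_simps)
  qed
  then have "bracket_on \<A> S \<xi> (\<lambda>q. ?A q (X q)) p = - lie_bracket \<xi> ?B p"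
    using bracket_on_eq[OF p extends_near_self[OF xi] xi_tangent[OF p] ext]
      lie_bracket_minus[OF xi B] by simp
  moreover have "bracket_on \<A> S \<xi> X p = lie_bracket \<xi> X' p"
    by (rule bracket_on_eq[OF p extends_near_self[OF xi] xi_tangent[OF p] X' Xt[OF p]])
  moreover have "?A p (lie_bracket \<xi> X' p) = - nab p (lie_bracket \<xi> X' p) W"
    by (rule shape_operator_eq[OF p N lie_bracket_VF[OF xi V(1)] lie_bracket_xi_tangent[OF p t]])
  moreover have "lie_derivative \<A> S \<xi> ?A X p = 0" using lp X p by (simp add: lie_parallel_def)
  ultimately show ?thesis by (simp add: lie_derivative_def)
qed

text \<open>\<open>umbilic_at\<close> tests against tangent fields. The defect \<open>d\<close> is
  itself tangent, so it extends to such a field and can be paired with itself; definiteness gives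
  \<open>d = 0\<close>.\<close>

lemma totally_umbilic:
  assumes N: "\<forall>q\<in>S. W q = N q"
    and lp: "lie_parallel \<A> k S \<xi> (shape_operator \<A> nab S N)"
    and ext: "\<And>p v. p \<in> S \<Longrightarrow> v \<in> tangent_sub \<A> k S p \<Longrightarrow>
      \<exists>X X'. tangent_field \<A> k S X \<and> extends_near \<A> S p X X' \<and> X' p = v"
  shows "totally_umbilic \<A> k S (shape_operator \<A> nab S N)"
  unfolding totally_umbilic_def
proof (intro exI[of _ "\<lambda>p. 1/2"] ballI)
  have near: "tangent_near p X'" if "p \<in> S" "tangent_field \<A> k S X" "extends_near \<A> S p X X'" for p X X'
    using that by (fastforce simp: tangent_near_def tangent_field_def extends_near_def)
  fix p v assume p: "p \<in> S" and v: "v \<in> tangent_sub \<A> k S p"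
  obtain X X' where X: "tangent_field \<A> k S X" "extends_near \<A> S p X X'" "X' p = v"
    using ext[OF p v] by blast
  note tX = near[OF p X(1,2)]
  note X' = tangent_nearD[OF p tX]
  note t = VF_T[OF X'(1), of p] VF_T[OF W, of p] nab_T[OF VF_T[OF X'(1)] W, of p]
  define d where "d = nab p (X' p) W + (1/2) *\<^sub>R X' p"
  have d: "d \<in> T p" using t by (simp add: d_def T_intros)
  have "d \<in> tangent_sub \<A> k S p"
    by (rule orthogonal_tangent[OF p d])
      (use t grad[OF t(3)] shape_facts(1)[OF p tX] normal[OF p X'(2)] in \<open>simp add: d_def g_simps T_intros\<close>)
  then obtain Y Y' where Y: "tangent_field \<A> k S Y" "extends_near \<A> S p Y Y'" "Y' p = d"
    using ext[OF p] by blast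
  have "g p d (Y' p) = 0"
    using umbilic_at[OF p tX near[OF p Y(1,2)] lie_parallel_at[OF p N lp X(1,2)]] t d
    by (simp add: Y(3)) (simp add: d_def g_simps T_intros g_sym[OF t(1,3)])
  then have "d = 0" using g_eq_0[OF d] Y(3) by simp
  then show "shape_operator \<A> nab S N p v = (1/2) *\<^sub>R v"
    using shape_operator_eq[OF p N X'(1,2)] X(3) unfolding d_def by (simp add: add_eq_0_iff)
qed

end

theorem theorem7p1:
  fixes \<A> :: "('m::{t2_space,second_countable_topology}, 'e::euclidean_space) chart set"
    and n :: nat
    and \<phi> :: "'m \<Rightarrow> 'm tvec \<Rightarrow> 'm tvec"
    and \<xi> :: "'m vfield"
    and \<eta> :: "'m \<Rightarrow> 'm tvec \<Rightarrow> real"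
    and g :: "'m metric"
    and f :: "'m \<Rightarrow> real"
    and c :: real
    and nab :: "'m connection"
    and S :: "'m set"
    and N W :: "'m vfield"
  assumes "conformal_kenmotsu_space_form n \<A> \<phi> \<xi> \<eta> g f c"
    and "levi_civita \<A> g nab"
    and "cr_hypersurface n \<A> \<phi> \<xi> g S N"
    and "lie_parallel \<A> (2 * n) S \<xi> (shape_operator \<A> nab S N)"
    and "is_sharp \<A> g (lee_form f) W"
    and "\<forall>p\<in>S. W p = N p"
  shows "totally_umbilic \<A> (2 * n) S (shape_operator \<A> nab S N)"
proof -
  have atlas: "smooth_atlas \<A>" and dim: "DIM('e) = Suc (2 * n)"
    and acm: "almost_contact_metric \<A> \<phi> \<xi> \<eta> g" and f: "smooth_fun \<A> f"
    and ken: "kenmotsu \<A> \<phi> (conf_xi f \<xi>) (conf_eta f \<eta>) (conf_metric f g)"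
    using assms(1) by (auto simp: conformal_kenmotsu_space_form_def conformal_kenmotsu_def)
  from ken obtain nab' where acm': "almost_contact_metric \<A> \<phi> (conf_xi f \<xi>) (conf_eta f \<eta>) (conf_metric f g)"
    and lc': "levi_civita \<A> (conf_metric f g) nab'"
    and nab': "\<And>X Y p. vector_field \<A> X \<Longrightarrow> vector_field \<A> Y \<Longrightarrow>
         nab' p (X p) (\<lambda>q. \<phi> q (Y q)) - \<phi> p (nab' p (X p) Y) =
           - (conf_metric f g p (X p) (\<phi> p (Y p)) *\<^sub>R conf_xi f \<xi> p) - conf_eta f \<eta> p (Y p) *\<^sub>R \<phi> p (X p)"
    unfolding kenmotsu_def by blast
  have met: "riemannian_metric \<A> g" and met': "riemannian_metric \<A> (conf_metric f g)"
    and xi: "vector_field \<A> \<xi>" and xi': "vector_field \<A> (conf_xi f \<xi>)"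
    using acm acm' by (auto simp: almost_contact_metric_def)
  \<comment> \<open>The conformal metric with its own connection \<open>nab'\<close> forms a second
    Riemannian manifold, in which \<open>kenmotsu_nab\<close> yields
    \<open>conf_nab\<close>.\<close>
  interpret conf: riemannian_manifold \<A> "conf_metric f g" nab'
    by unfold_locales (fact atlas met' lc')+
  have conf_nab: "nab' p (X p) (conf_xi f \<xi>) =
      X p - conf_metric f g p (X p) (conf_xi f \<xi> p) *\<^sub>R conf_xi f \<xi> p"
    if "vector_field \<A> X" for X p
    by (rule conf.kenmotsu_nab[OF acm' _ that]) (rule nab')
  have unit: "g p (\<xi> p) (\<xi> p) = 1" for p
    using acm conf.VF_T[OF xi, of p] unfolding almost_contact_metric_def by metis
  have W: "vector_field \<A> W" and grad: "\<And>v p. v \<in> tangent_space \<A> p \<Longrightarrow> g p (W p) v = v f"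
    using assms(5) by (auto simp: is_sharp_def lee_form_def)
  have emb: "embedded_submanifold \<A> (2 * n) S" and N: "unit_normal_field \<A> (2 * n) g S N"
    and xit: "\<And>p. p \<in> S \<Longrightarrow> \<xi> p \<in> tangent_sub \<A> (2 * n) S p"
    and "\<exists>D D'. cr_decomposition \<A> (2 * n) \<phi> g S D D'"
    using assms(3) unfolding cr_hypersurface_def by blast+
  then obtain D D' where cr: "cr_decomposition \<A> (2 * n) \<phi> g S D D'" by blast
  \<comment> \<open>Normality and unit length pass from \<open>N\<close> to the globally defined
    field \<open>W\<close>, which agrees with it on \<open>S\<close>.\<close>
  interpret gradient_normal_hypersurface \<A> g nab \<xi> W f nab' "2 * n" S
    by unfold_locales
      (use conf_nab N assms(6) in
        \<open>auto simp: met assms(2) xi unit f W grad xi' met' lc' emb dim xit unit_normal_field_def normal_sub_def\<close>)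
  show ?thesis
  proof (rule totally_umbilic[OF assms(6,4)])
    fix p v assume p: "p \<in> S" "v \<in> tangent_sub \<A> (2 * n) S p"
    show "\<exists>X X'. tangent_field \<A> (2 * n) S X \<and> extends_near \<A> S p X X' \<and> X' p = v"
      using conf.cr_tangent_field[OF cr p] p(1) unfolding extends_near_def by (metis IntI)
  qed
qed

end
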